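(* Let $\mathcal{H}_A,\mathcal{H}_B,\mathcal{H}_C$ be finite-dimensional Hilbert spaces, and let $\mathcal{S},\mathcal{T}\subseteq\mathbb{B}(\mathcal{H}_A)$ be subalgebras forming a commuting square, i.e. $\mathcal{E}_{\mathcal{S}}\mathcal{E}_{\mathcal{T}}=\mathcal{E}_{\mathcal{T}}\mathcal{E}_{\mathcal{S}}=\mathcal{E}_{\mathcal{S}\cap\mathcal{T}}$. Then for every density $\rho^{ABC}$ on $\mathcal{H}_A\otimes\mathcal{H}_B\otimes\mathcal{H}_C$, \[ H(\mathcal{E}_{\mathcal{S}}^c\,|\,\mathcal{B})_\rho + H(\mathcal{T}\,|\,\mathcal{C})_\rho \ \ge\ H(\mathcal{S}\cap\mathcal{T}\,|\,\mathcal{C})_\rho . \]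
   Context: For a subalgebra $\mathcal{N}\subseteq\mathbb{B}(\mathcal{H}_A)$, $\mathcal{E}_{\mathcal{N}}$ is the unique trace-preserving conditional expectation onto $\mathcal{N}$ (the completely positive trace-preserving map with $\operatorname{tr}(ab)=\operatorname{tr}(\mathcal{E}_{\mathcal{N}}(a)b)$ for all $a\in\mathbb{B}(\mathcal{H}_A)$, $b\in\mathcal{N}$). $H(\sigma)=-\operatorname{tr}\sigma\log\sigma$, and $\rho^{AB},\rho^{AC},\rho^B,\rho^C$ denote reduced densities. Define $H(\mathcal{N}|\mathcal{C})_\rho := H((\mathcal{E}_{\mathcal{N}}\otimes \mathrm{id}_C)(\rho^{AC})) - H(\rho^C)$. The complementary channel $\mathcal{E}_{\mathcal{S}}^c$ is defined from a Stinespring dilation: if $V:\mathcal{H}_A\to\mathcal{H}_A\otimes\mathcal{H}_F$ is an isometry with $\mathcal{E}_{\mathcal{S}}(X)=\operatorname{tr}_F(VXV^* )$, then $\mathcal{E}_{\mathcal{S}}^c(X)=\operatorname{tr}_A(VXV^* )$ (a channel into densities on $\mathcal{H}_F$; the entropies below do not depend on the choice of dilation). Define $H(\mathcal{E}_{\mathcal{S}}^c|\mathcal{B})_\rho := H((\mathcal{E}_{\mathcal{S}}^c\otimes\mathrm{id}_B)(\rho^{AB})) - H(\rho^B)$. *)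

theory Defs
  imports "Jordan_Normal_Form.Char_Poly" "HOL-Computational_Algebra.Polynomial"
begin

definition adj :: "complex mat \<Rightarrow> complex mat" where
  "adj A = mat (dim_col A) (dim_row A) (\<lambda>(i,j). cnj (A $$ (j,i)))"

definition mtrace :: "complex mat \<Rightarrow> complex" where
  "mtrace A = (\<Sum>i<dim_row A. A $$ (i,i))"

definition psd :: "nat \<Rightarrow> complex mat \<Rightarrow> bool" where
  "psd n A \<longleftrightarrow> A \<in> carrier_mat n n \<and> adj A = A \<and>
     (\<forall>v \<in> carrier_vec n. 0 \<le> Re (\<Sum>i<n. cnj (v $ i) * (A *\<^sub>v v) $ i))"

definition density :: "nat \<Rightarrow> complex mat \<Rightarrow> bool" where
  "density n \<rho> \<longleftrightarrow> psd n \<rho> \<and> mtrace \<rho> = 1"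

text \<open>von Neumann entropy H(s) = - tr s log s = - sum over eigenvalues (with multiplicity)
  of lambda * ln lambda  (with the convention 0 ln 0 = 0, which holds as ln 0 = 0 in HOL).\<close>
definition vn_entropy :: "complex mat \<Rightarrow> real" where
  "vn_entropy \<sigma> = - (\<Sum>x \<in># proots (char_poly \<sigma>). Re x * ln (Re x))"

text \<open>C^m \<otimes> C^n is identified with C^(m*n) via (i,k) \<mapsto> i*n + k (first factor is the
  most significant index).\<close>

definition blk :: "nat \<Rightarrow> nat \<Rightarrow> complex mat \<Rightarrow> nat \<Rightarrow> nat \<Rightarrow> complex mat" where
  "blk dX dY \<rho> k l = mat dX dX (\<lambda>(i,j). \<rho> $$ (i*dY + k, j*dY + l))"

text \<open>(Phi \<otimes> id_Y)(rho) for a linear map Phi from dX x dX to dZ x dZ matrices: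
  sum over k,l of Phi(blk k l) \<otimes> |k><l|.\<close>
definition on_first :: "nat \<Rightarrow> nat \<Rightarrow> nat \<Rightarrow> (complex mat \<Rightarrow> complex mat) \<Rightarrow> complex mat \<Rightarrow> complex mat" where
  "on_first dX dY dZ \<Phi> \<rho> = mat (dZ*dY) (dZ*dY)
     (\<lambda>(r,s). \<Phi> (blk dX dY \<rho> (r mod dY) (s mod dY)) $$ (r div dY, s div dY))"

definition ptrace2 :: "nat \<Rightarrow> nat \<Rightarrow> complex mat \<Rightarrow> complex mat" where
  "ptrace2 dX dY \<rho> = mat dX dX (\<lambda>(i,j). \<Sum>k<dY. \<rho> $$ (i*dY + k, j*dY + k))"

definition ptrace1 :: "nat \<Rightarrow> nat \<Rightarrow> complex mat \<Rightarrow> complex mat" where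
  "ptrace1 dX dY \<rho> = mat dY dY (\<lambda>(k,l). \<Sum>i<dX. \<rho> $$ (i*dY + k, i*dY + l))"

text \<open>Reduced densities of rho^{ABC} on C^dA \<otimes> C^dB \<otimes> C^dC, index ((a*dB+b)*dC+c).\<close>
definition red_AB :: "nat \<Rightarrow> nat \<Rightarrow> nat \<Rightarrow> complex mat \<Rightarrow> complex mat" where
  "red_AB dA dB dC \<rho> = ptrace2 (dA*dB) dC \<rho>"

definition red_AC :: "nat \<Rightarrow> nat \<Rightarrow> nat \<Rightarrow> complex mat \<Rightarrow> complex mat" where
  "red_AC dA dB dC \<rho> = mat (dA*dC) (dA*dC)
     (\<lambda>(r,s). \<Sum>b<dB. \<rho> $$ (((r div dC)*dB + b)*dC + r mod dC, ((s div dC)*dB + b)*dC + s mod dC))"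

definition red_B :: "nat \<Rightarrow> nat \<Rightarrow> nat \<Rightarrow> complex mat \<Rightarrow> complex mat" where
  "red_B dA dB dC \<rho> = ptrace1 dA dB (red_AB dA dB dC \<rho>)"

definition red_C :: "nat \<Rightarrow> nat \<Rightarrow> nat \<Rightarrow> complex mat \<Rightarrow> complex mat" where
  "red_C dA dB dC \<rho> = ptrace1 dA dC (red_AC dA dB dC \<rho>)"

definition subalgebra :: "nat \<Rightarrow> complex mat set \<Rightarrow> bool" where
  "subalgebra n N \<longleftrightarrow> N \<subseteq> carrier_mat n n \<and> 1\<^sub>m n \<in> N \<and>
     (\<forall>a\<in>N. \<forall>b\<in>N. a + b \<in> N \<and> a * b \<in> N) \<and>
     (\<forall>c. \<forall>a\<in>N. c \<cdot>\<^sub>m a \<in> N) \<and> (\<forall>a\<in>N. adj a \<in> N)"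

definition cond_exp :: "complex mat set \<Rightarrow> complex mat \<Rightarrow> complex mat" where
  "cond_exp N a = (THE x. x \<in> N \<and> (\<forall>b\<in>N. mtrace (a * b) = mtrace (x * b)))"

definition cond_ent_alg :: "nat \<Rightarrow> nat \<Rightarrow> nat \<Rightarrow> complex mat set \<Rightarrow> complex mat \<Rightarrow> real" where
  "cond_ent_alg dA dB dC N \<rho> =
     vn_entropy (on_first dA dC dA (cond_exp N) (red_AC dA dB dC \<rho>)) - vn_entropy (red_C dA dB dC \<rho>)"

definition stinespring :: "nat \<Rightarrow> nat \<Rightarrow> complex mat set \<Rightarrow> complex mat \<Rightarrow> bool" where
  "stinespring dA dF S V \<longleftrightarrow> V \<in> carrier_mat (dA*dF) dA \<and> adj V * V = 1\<^sub>m dA \<and>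
     (\<forall>X \<in> carrier_mat dA dA. cond_exp S X = ptrace2 dA dF (V * X * adj V))"

definition compl_ch :: "nat \<Rightarrow> nat \<Rightarrow> complex mat \<Rightarrow> complex mat \<Rightarrow> complex mat" where
  "compl_ch dA dF V X = ptrace1 dA dF (V * X * adj V)"

definition cond_ent_compl :: "nat \<Rightarrow> nat \<Rightarrow> nat \<Rightarrow> nat \<Rightarrow> complex mat \<Rightarrow> complex mat \<Rightarrow> real" where
  "cond_ent_compl dA dB dC dF V \<rho> =
     vn_entropy (on_first dA dB dF (compl_ch dA dF V) (red_AB dA dB dC \<rho>)) - vn_entropy (red_B dA dB dC \<rho>)"

end

theory Submission
  imports Defs "Jordan_Normal_Form.Schur_Decomposition"
begin

text \<open>Purify the state by a space \<open>D\<close>. Complementary spectra agree, so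
  \<open>H(E\<^sub>S\<^sup>c|B) = H(E\<^sub>S \<rho>\<^sup>A\<^sup>C\<^sup>D) - H(\<rho>\<^sup>A\<^sup>C\<^sup>D)\<close>, which is the relative entropy of \<open>\<rho>\<^sup>A\<^sup>C\<^sup>D\<close> and \<open>E\<^sub>S \<rho>\<^sup>A\<^sup>C\<^sup>D\<close>.
  Applying \<open>E\<^sub>T\<close> and tracing out \<open>D\<close> turns this pair into \<open>E\<^sub>T \<rho>\<^sup>A\<^sup>C\<close> and, by the commuting square,
  \<open>E\<^sub>S\<^sub>\<inter>\<^sub>T \<rho>\<^sup>A\<^sup>C\<close>, whose relative entropy is \<open>H(S \<inter> T|C) - H(T|C)\<close>; the claim is thus an instance of data
  processing. The latter holds because the relative entropy is an integral over \<open>t > 0\<close> of the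
  quantities \<open>sup\<^sub>X 2 Re tr(\<rho> X\<^sup>*) - tr(\<sigma> X X\<^sup>*) - t tr(\<rho> X\<^sup>* X)\<close>, each of which decreases: for the image
  pair the supremum may be restricted to \<open>X\<close> in \<open>T\<close>, and then \<open>X \<otimes> 1\<close> is a competitor for the original pair.\<close>

subsection \<open>Adjoints, traces and the spectral theorem\<close>

text \<open>In eigenbases of the two states, with eigenvalues \<open>p i\<close> and
  \<open>q j\<close>, the expression under the supremum splits into independent scalar quadratics.
  Its maximum is a sum of terms \<open>c / (x + t)\<close>, where \<open>x = q j / p i\<close> runs
  over the spectrum of the relative modular operator and \<open>c\<close> is \<open>p i\<close>
  times the squared overlap of the eigenvectors. The integral over \<open>t\<close> is never formed:
  its antiderivative is a sum of logarithms \<open>ln (x + t)\<close>, so a comparison for every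
  \<open>t\<close> becomes monotonicity of a difference of such sums. A supremum is compared by
  exhibiting a competitor. Passing from \<open>X\<close> to \<open>X\<close> tensor 1 preserves
  products and adjoints, so traces against the reduced first state become traces against the full
  one. For the second state the same exchange is available against elements of \<open>T\<close>,
  where the expectation onto the intersection, being that onto \<open>T\<close> after that onto
  \<open>S\<close>, may be replaced by the latter. Hence the projection of competitors to
  \<open>T\<close>. States may be singular. That the support of the first lies in that of the
  second, and that conditional expectations are positive, both come from the moment
  identities.\<close>

lemma adj_index [simp]: "i < dim_col A \<Longrightarrow> j < dim_row A \<Longrightarrow> adj A $$ (i, j) = cnj (A $$ (j, i))"
  by (simp add: adj_def)

lemma adj_dim [simp]: "dim_row (adj A) = dim_col A" "dim_col (adj A) = dim_row A"
  by (simp_all add: adj_def)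

lemma adj_carrier [simp]: "A \<in> carrier_mat n m \<Longrightarrow> adj A \<in> carrier_mat m n"
  by (intro carrier_matI) auto

lemma adj_adj [simp]: "adj (adj A) = A"
  by (rule eq_matI) auto

lemma adj_one [simp]: "adj (1\<^sub>m n) = 1\<^sub>m n"
  by (rule eq_matI) auto

lemma adj_add: "A \<in> carrier_mat n m \<Longrightarrow> B \<in> carrier_mat n m \<Longrightarrow> adj (A + B) = adj A + adj B"
  by (rule eq_matI) auto

lemma index_mult_sum:
  "A \<in> carrier_mat n m \<Longrightarrow> B \<in> carrier_mat m k \<Longrightarrow> i < n \<Longrightarrow> j < k \<Longrightarrow>
    (A * B) $$ (i, j) = (\<Sum>l<m. A $$ (i, l) * B $$ (l, j))"
  by (auto simp: scalar_prod_def lessThan_atLeast0 intro!: sum.cong)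

lemma adj_mult:
  assumes "dim_col A = dim_row B"
  shows "adj (A * B) = adj B * adj A"
  using assms
  by (intro eq_matI) (auto simp: scalar_prod_def mult.commute intro!: sum.cong)

text \<open>Equations between dimensions, unlike carrier memberships, leave no size to be guessed,
  so the simplifier can reassociate with this rule.\<close>

lemma mult_assoc_dim:
  "dim_col A = dim_row B \<Longrightarrow> dim_col B = dim_row C \<Longrightarrow> (A * B) * C = A * (B * C)"
  for A B C :: "complex mat"
  by (rule assoc_mult_mat) auto

lemma left_mult_one_dim: "dim_row A = n \<Longrightarrow> 1\<^sub>m n * A = A" for A :: "complex mat"
  by auto

lemma right_mult_one_dim: "dim_col A = n \<Longrightarrow> A * 1\<^sub>m n = A" for A :: "complex mat"
  by auto

lemma mtrace_add:
  "A \<in> carrier_mat n n \<Longrightarrow> B \<in> carrier_mat n n \<Longrightarrow> mtrace (A + B) = mtrace A + mtrace B"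
  by (simp add: mtrace_def sum.distrib)

lemma mtrace_minus:
  "A \<in> carrier_mat n n \<Longrightarrow> B \<in> carrier_mat n n \<Longrightarrow> mtrace (A - B) = mtrace A - mtrace B"
  by (simp add: mtrace_def sum_subtractf)

lemma mtrace_adj: "A \<in> carrier_mat n n \<Longrightarrow> mtrace (adj A) = cnj (mtrace A)"
  by (simp add: mtrace_def)

lemma mtrace_mult_sum:
  "A \<in> carrier_mat n m \<Longrightarrow> B \<in> carrier_mat m n \<Longrightarrow>
    mtrace (A * B) = (\<Sum>i<n. \<Sum>j<m. A $$ (i, j) * B $$ (j, i))"
  by (auto simp: mtrace_def index_mult_sum[where n=n and m=m and k=n]
      simp del: index_mult_mat(1) intro!: sum.cong)

lemma mtrace_comm:
  assumes "A \<in> carrier_mat n m" "B \<in> carrier_mat m n"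
  shows "mtrace (A * B) = mtrace (B * A)"
  unfolding mtrace_mult_sum[OF assms] mtrace_mult_sum[OF assms(2,1)]
  by (subst sum.swap) (simp add: mult.commute)

definition unitary :: "nat \<Rightarrow> complex mat \<Rightarrow> bool" where
  "unitary n U \<longleftrightarrow> U \<in> carrier_mat n n \<and> adj U * U = 1\<^sub>m n \<and> U * adj U = 1\<^sub>m n"

definition real_diag :: "nat \<Rightarrow> (nat \<Rightarrow> real) \<Rightarrow> complex mat" where
  "real_diag n d = mat n n (\<lambda>(i, j). if i = j then of_real (d i) else 0)"

lemma real_diag_carrier [simp]: "real_diag n d \<in> carrier_mat n n"
    and real_diag_dim [simp]: "dim_row (real_diag n d) = n" "dim_col (real_diag n d) = n"
  by (simp_all add: real_diag_def)

lemma unitaryI: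
  assumes "U \<in> carrier_mat n n" "adj U * U = 1\<^sub>m n"
  shows "unitary n U"
  using assms mat_mult_left_right_inverse[of "adj U" n U] by (simp add: unitary_def)

text \<open>The last two facts cancel a unitary at the head of a product associated to the
  right.\<close>

lemma unitaryD:
  assumes "unitary n U"
  shows "U \<in> carrier_mat n n" "dim_row U = n" "dim_col U = n" "adj U * U = 1\<^sub>m n" "U * adj U = 1\<^sub>m n"
    "\<And>X. dim_row X = n \<Longrightarrow> adj U * (U * X) = X" "\<And>X. dim_row X = n \<Longrightarrow> U * (adj U * X) = X"
  using assms by (auto simp: unitary_def left_mult_one_dim simp flip: mult_assoc_dim)

lemma unitary_adj: "unitary n U \<Longrightarrow> unitary n (adj U)"
  by (simp add: unitary_def)

lemma unitary_mult:
  assumes "unitary n U" "unitary n W"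
  shows "unitary n (U * W)"
  using unitaryD[OF assms(1)] unitaryD[OF assms(2)]
  by (intro unitaryI) (auto simp: adj_mult mult_assoc_dim)

lemma block_diag_mult:
  fixes A A' D D' :: "complex mat"
  assumes "A \<in> carrier_mat n n" "A' \<in> carrier_mat n n" "D \<in> carrier_mat m m" "D' \<in> carrier_mat m m"
  shows "four_block_mat A (0\<^sub>m n m) (0\<^sub>m m n) D * four_block_mat A' (0\<^sub>m n m) (0\<^sub>m m n) D'
    = four_block_mat (A * A') (0\<^sub>m n m) (0\<^sub>m m n) (D * D')"
proof -
  have "A * A' \<in> carrier_mat n n" "D * D' \<in> carrier_mat m m" using assms by auto
  then show ?thesis
    using mult_four_block_mat[OF assms(1) zero_carrier_mat[of n m] zero_carrier_mat[of m n] assms(3)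
        assms(2) zero_carrier_mat zero_carrier_mat assms(4)] assms
    by simp
qed

lemma adj_four_block:
  assumes "A \<in> carrier_mat n n" "B \<in> carrier_mat n m" "C \<in> carrier_mat m n" "D \<in> carrier_mat m m"
  shows "adj (four_block_mat A B C D) = four_block_mat (adj A) (adj C) (adj B) (adj D)"
  using assms by (intro eq_matI) auto

text \<open>Complete \<open>v\<close> to a basis, orthogonalize by Gram-Schmidt, which keeps the
  first vector, and normalize the columns.\<close>

lemma unitary_with_first_column:
  fixes v :: "complex vec"
  assumes v: "v \<in> carrier_vec n" and v0: "v \<noteq> 0\<^sub>v n"
  obtains U c where "unitary n U" "c \<noteq> 0" "col U 0 = c \<cdot>\<^sub>v v"
proof -
  define b where "b = basis_completion v"
  define ws where "ws = gram_schmidt n b"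
  interpret cof_vec_space n "TYPE(complex)" .
  from v0 v have n: "n > 0" by (metis carrier_vecD gr0I vec_eq_iff zero_carrier_vec less_nat_zero_code)
  from basis_completion[OF v v0, folded b_def]
  have dist_b: "distinct b" and indep: "\<not> lin_dep (set b)" and b: "set b \<subseteq> carrier_vec n"
    and hdb: "hd b = v" and len_b: "length b = n" by auto
  from hdb len_b n obtain vs where bv: "b = v # vs" by (cases b) auto
  from gram_schmidt_result[OF b dist_b indep refl, folded ws_def]
  have ws: "set ws \<subseteq> carrier_vec n" "corthogonal ws" "length ws = n" by (auto simp: len_b)
  from gram_schmidt_hd[OF v, of vs, folded bv] have hdws: "ws ! 0 = v"
    unfolding ws_def[symmetric] using ws n by (cases ws) auto
  define N where "N j = sqrt (\<Sum>i<n. (cmod (ws ! j $ i))\<^sup>2)" for j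
  have wsc: "ws ! j \<in> carrier_vec n" if "j < n" for j using ws that by auto
  have ip: "ws ! i \<bullet>c ws ! j = (\<Sum>k<n. ws ! i $ k * cnj (ws ! j $ k))" if "i < n" "j < n" for i j
    using wsc[OF that(1)] wsc[OF that(2)] by (auto simp: scalar_prod_def lessThan_atLeast0)
  have ip_self: "ws ! j \<bullet>c ws ! j = of_real ((N j)\<^sup>2)" if "j < n" for j
    unfolding ip[OF that that] N_def
    by (simp add: sum_nonneg complex_norm_square[symmetric])
  have N0: "N j \<noteq> 0" if "j < n" for j
    using corthogonalD[OF ws(2), of j j] ws(3) that ip_self[OF that] by auto
  define U where "U = mat n n (\<lambda>(i, j). ws ! j $ i / of_real (N j))"
  have U: "U \<in> carrier_mat n n" by (simp add: U_def)
  have "adj U * U = 1\<^sub>m n"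
  proof (rule eq_matI)
    fix i j assume ij: "i < dim_row (1\<^sub>m n)" "j < dim_col (1\<^sub>m n)"
    have "(adj U * U) $$ (i, j) = (\<Sum>l<n. adj U $$ (i, l) * U $$ (l, j))"
      using U ij by (intro index_mult_sum) auto
    also have "\<dots> = (\<Sum>l<n. ws ! j $ l * cnj (ws ! i $ l)) / (of_real (N i) * of_real (N j))"
      using ij U unfolding sum_divide_distrib by (intro sum.cong) (auto simp: U_def mult.commute)
    also have "\<dots> = (ws ! j \<bullet>c ws ! i) / (of_real (N i) * of_real (N j))"
      using ij by (simp add: ip)
    also have "\<dots> = 1\<^sub>m n $$ (i, j)"
      using ij ip_self[of i] N0[of i] corthogonalD[OF ws(2), of j i] ws(3)
      by (auto simp: power2_eq_square)
    finally show "(adj U * U) $$ (i, j) = 1\<^sub>m n $$ (i, j)" .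
  qed (use U in auto)
  then have "unitary n U" using U by (intro unitaryI)
  moreover have "1 / of_real (N 0) \<noteq> (0::complex)" using N0[OF n] by simp
  moreover have "col U 0 = (1 / of_real (N 0)) \<cdot>\<^sub>v v"
    using n v hdws by (intro eq_vecI) (auto simp: U_def)
  ultimately show ?thesis by (rule that)
qed

text \<open>Deflation: in a unitary frame starting with an eigenvector, the first column of the
  matrix is a multiple of the first unit vector. Hermiticity clears the first row too and makes the
  eigenvalue real, and the induction hypothesis treats the remaining block.\<close>

lemma hermitian_diagonalization:
  assumes "A \<in> carrier_mat n n" "adj A = A"
  shows "\<exists>U d. unitary n U \<and> A = U * real_diag n d * adj U"
  using assms
proof (induction n arbitrary: A)
  case 0
  then show ?case
    by (intro exI[of _ "1\<^sub>m 0"] exI[of _ "\<lambda>_. 0"]) (auto simp: unitary_def)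
next
  case (Suc m)
  let ?n = "Suc m"
  note A = Suc.prems(1) and hA = Suc.prems(2)
  have "degree (char_poly A) = ?n" using degree_monic_char_poly[OF A] by simp
  then obtain e where "poly (char_poly A) e = 0"
    using fundamental_theorem_of_algebra_alt[of "char_poly A"]
    by (metis degree_pCons_0 nat.distinct(1) pCons_0_as_mult degree_0)
  then have "eigenvalue A e" using eigenvalue_root_char_poly[OF A] by simp
  then obtain v where v: "v \<in> carrier_vec ?n" "v \<noteq> 0\<^sub>v ?n" and Av: "A *\<^sub>v v = e \<cdot>\<^sub>v v"
    using A unfolding eigenvalue_def eigenvector_def by auto
  obtain W c where W: "unitary ?n W" and c: "c \<noteq> 0" and colW: "col W 0 = c \<cdot>\<^sub>v v"
    using unitary_with_first_column[OF v] by blast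
  note W' = W[unfolded unitary_def]
  note dW = unitaryD(2-)[OF W]
  define B where "B = adj W * (A * W)"
  have B: "B \<in> carrier_mat ?n ?n" using W' A by (auto simp: B_def)
  have hB: "adj B = B"
    using dW A hA unfolding B_def by (simp add: adj_mult mult_assoc_dim)
  have colAW: "col (A * W) 0 = e \<cdot>\<^sub>v col W 0"
    using A W' v Av colW col_mult2[of A ?n ?n W ?n 0] by (simp add: mult_mat_vec smult_smult_assoc mult.commute)
  have Bi0: "B $$ (i, 0) = (if i = 0 then e else 0)" if "i < ?n" for i
  proof -
    have "B $$ (i, 0) = row (adj W) i \<bullet> (e \<cdot>\<^sub>v col W 0)"
      unfolding B_def colAW[symmetric] using that A W' by (intro index_mult_mat(1)) auto
    also have "\<dots> = e * (row (adj W) i \<bullet> col W 0)" using that W' by simp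
    also have "row (adj W) i \<bullet> col W 0 = (adj W * W) $$ (i, 0)"
      by (intro index_mult_mat(1)[symmetric]) (use that W' in auto)
    finally show ?thesis using that W' by simp
  qed
  have B0i: "B $$ (0, i) = (if i = 0 then cnj e else 0)" if "i < ?n" for i
    using that B Bi0[OF that] arg_cong[OF hB, of "\<lambda>M. M $$ (0, i)"] by auto
  have e: "e = cnj e" using Bi0[of 0] B0i[of 0] by simp
  then have eR: "of_real (Re e) = e" by (metis Reals_cnj_iff of_real_Re)
  define B' where "B' = mat m m (\<lambda>(i, j). B $$ (Suc i, Suc j))"
  have B': "B' \<in> carrier_mat m m" by (simp add: B'_def)
  have "adj B' = B'"
  proof (rule eq_matI)
    fix i j assume "i < dim_row B'" "j < dim_col B'"
    then show "adj B' $$ (i, j) = B' $$ (i, j)"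
      using B arg_cong[OF hB, of "\<lambda>M. M $$ (Suc i, Suc j)"] by (auto simp: B'_def)
  qed (simp_all add: B'_def)
  from Suc.IH[OF B' this] obtain U d where U: "unitary m U" and BU: "B' = U * real_diag m d * adj U"
    by blast
  note U' = U[unfolded unitary_def]
  let ?E = "mat 1 1 (\<lambda>_. e)"
  define U1 where "U1 = four_block_mat (1\<^sub>m 1) (0\<^sub>m 1 m) (0\<^sub>m m 1) U"
  define d1 where "d1 = (\<lambda>i. case i of 0 \<Rightarrow> Re e | Suc j \<Rightarrow> d j)"
  have U1: "U1 \<in> carrier_mat ?n ?n" unfolding U1_def using U' by (metis four_block_carrier_mat one_carrier_mat plus_1_eq_Suc)
  have aU1: "adj U1 = four_block_mat (1\<^sub>m 1) (0\<^sub>m 1 m) (0\<^sub>m m 1) (adj U)"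
    unfolding U1_def using U' by (subst adj_four_block[where n=1 and m=m]) auto
  have uU1: "unitary ?n U1"
  proof (rule unitaryI[OF U1])
    show "adj U1 * U1 = 1\<^sub>m ?n"
      unfolding aU1 unfolding U1_def
      using block_diag_mult[OF one_carrier_mat[of 1] one_carrier_mat adj_carrier[OF conjunct1[OF U']] conjunct1[OF U']]
        four_block_one_mat[of 1 m] unitaryD(4)[OF U] left_mult_one_mat[OF one_carrier_mat[of 1]]
      by (metis plus_1_eq_Suc)
  qed
  have dg: "real_diag ?n d1 = four_block_mat ?E (0\<^sub>m 1 m) (0\<^sub>m m 1) (real_diag m d)"
    by (intro eq_matI) (auto simp: real_diag_def d1_def eR split: nat.splits)
  have Bblock: "B = four_block_mat ?E (0\<^sub>m 1 m) (0\<^sub>m m 1) B'"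
    using B Bi0 B0i e by (intro eq_matI) (auto simp: B'_def)
  have E: "?E \<in> carrier_mat 1 1" "1\<^sub>m 1 \<in> carrier_mat 1 1" by auto
  have "U1 * real_diag ?n d1 = four_block_mat ?E (0\<^sub>m 1 m) (0\<^sub>m m 1) (U * real_diag m d)"
    unfolding U1_def dg
    using block_diag_mult[OF E(2,1) conjunct1[OF U'] real_diag_carrier[of m d]] left_mult_one_mat[OF E(1)]
    by metis
  moreover have "four_block_mat ?E (0\<^sub>m 1 m) (0\<^sub>m m 1) (U * real_diag m d) * adj U1 = B"
    unfolding aU1 Bblock BU
    using block_diag_mult[OF E mult_carrier_mat[OF conjunct1[OF U'] real_diag_carrier[of m d]]
        adj_carrier[OF conjunct1[OF U']]] right_mult_one_mat[OF E(1)]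
    by metis
  ultimately have "U1 * real_diag ?n d1 * adj U1 = B" by simp
  then have "W * B * adj W = W * (U1 * real_diag ?n d1 * adj U1) * adj W" by simp
  also have "\<dots> = (W * U1) * real_diag ?n d1 * adj (W * U1)"
    using dW unitaryD(2,3)[OF uU1] by (simp add: adj_mult mult_assoc_dim)
  also have "W * B * adj W = A"
    unfolding B_def using dW A by (simp add: mult_assoc_dim right_mult_one_dim)
  finally show ?case using unitary_mult[OF W uU1] by blast
qed

subsection \<open>Spectral form of the entropy\<close>

text \<open>The entropy depends only on the characteristic polynomial, which similarity preserves;
  hence any diagonalization computes it.\<close>

lemma vn_entropy_unitary_diag:
  assumes "unitary n U" "A = U * real_diag n d * adj U"
  shows "vn_entropy A = - (\<Sum>i<n. d i * ln (d i))"
proof -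
  have "similar_mat A (real_diag n d)"
    unfolding similar_mat_def similar_mat_wit_def Let_def
    using unitaryD[OF assms(1)] assms(2)
    by (intro exI[of _ U] exI[of _ "adj U"]) auto
  then have "char_poly A = char_poly (real_diag n d)" by (rule char_poly_similar)
  also have "\<dots> = (\<Prod>a\<leftarrow>diag_mat (real_diag n d). [:- a, 1:])"
    by (rule char_poly_upper_triangular[of _ n]) (auto simp: real_diag_def)
  also have "\<dots> = (\<Prod>i\<leftarrow>[0..<n]. [:- complex_of_real (d i), 1:])"
    by (intro arg_cong[of _ _ prod_list]) (auto simp: diag_mat_def real_diag_def)
  also have "\<dots> = (\<Prod>i<n. [:- complex_of_real (d i), 1:])"
    by (induction n) (auto simp: mult.commute)
  finally have "proots (char_poly A) = (\<Sum>i<n. {#complex_of_real (d i)#})"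
    by (simp add: proots_prod)
  moreover have "(\<Sum>x\<in>#(\<Sum>i\<in>I. {#complex_of_real (d i)#}). Re x * ln (Re x)) = (\<Sum>i\<in>I. d i * ln (d i))"
    for I :: "nat set"
    by (induction I rule: infinite_finite_induct) auto
  ultimately show ?thesis by (simp add: vn_entropy_def)
qed

text \<open>The state on the column side of a purification comes out as a transposed Gram matrix;
  this removes the transpose.\<close>

lemma vn_entropy_transpose:
  "A \<in> carrier_mat n n \<Longrightarrow> vn_entropy (transpose_mat A) = vn_entropy A"
  by (simp add: vn_entropy_def)

text \<open>Both sides are the determinant of \<open>((x, A), (B, 1))\<close>, reduced by block row or column operations.\<close>

lemma char_poly_mult_commute:
  fixes A B :: "complex mat"
  assumes A: "A \<in> carrier_mat n m" and B: "B \<in> carrier_mat m n"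
  shows "[:0, 1:] ^ m * char_poly (A * B) = [:0, 1:] ^ n * char_poly (B * A)"
proof -
  let ?x = "[:0, 1:] :: complex poly"
  define A' where "A' = map_mat (\<lambda>a. [:a:]) A"
  define B' where "B' = map_mat (\<lambda>a. [:a:]) B"
  have c: "A' \<in> carrier_mat n m" "B' \<in> carrier_mat m n" "- B' \<in> carrier_mat m n"
    "?x \<cdot>\<^sub>m 1\<^sub>m n \<in> carrier_mat n n" "?x \<cdot>\<^sub>m 1\<^sub>m m \<in> carrier_mat m m"
    "1\<^sub>m n \<in> carrier_mat n n" "1\<^sub>m m \<in> carrier_mat m m"
    "0\<^sub>m n m \<in> carrier_mat n m" "0\<^sub>m m n \<in> carrier_mat m n"
    using A B by (auto simp: A'_def B'_def)
  have char: "char_poly (C * D) = det (?x \<cdot>\<^sub>m 1\<^sub>m k - map_mat (\<lambda>a. [:a:]) C * map_mat (\<lambda>a. [:a:]) D)"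
    if "C \<in> carrier_mat k l" "D \<in> carrier_mat l k" for C D :: "complex mat" and k l
  proof -
    interpret h: semiring_hom "\<lambda>a :: complex. [:a:]" by standard auto
    have "map_mat (\<lambda>a. [:a:]) (C * D) = map_mat (\<lambda>a. [:a:]) C * map_mat (\<lambda>a. [:a:]) D"
      using that by (rule h.mat_hom_mult)
    moreover have "map_mat (\<lambda>a. [:- a:]) (C * D) = - map_mat (\<lambda>a. [:a:]) (C * D)" by auto
    ultimately show ?thesis
      using that unfolding char_poly_def char_poly_matrix_def
      by (intro arg_cong[of _ _ det] eq_matI) auto
  qed
  let ?M = "four_block_mat (?x \<cdot>\<^sub>m 1\<^sub>m n) A' B' (1\<^sub>m m)"
  let ?R = "four_block_mat (1\<^sub>m n) (0\<^sub>m n m) (- B') (1\<^sub>m m)"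
  let ?L = "four_block_mat (1\<^sub>m n) (0\<^sub>m n m) (- B') (?x \<cdot>\<^sub>m 1\<^sub>m m)"
  have MR: "?M * ?R = four_block_mat (?x \<cdot>\<^sub>m 1\<^sub>m n - A' * B') A' (0\<^sub>m m n) (1\<^sub>m m)"
    unfolding mult_four_block_mat[OF c(4,1,2,7) c(6,8,3,7)] using c
    by (intro cong_four_block_mat) auto
  have LM: "?L * ?M = four_block_mat (?x \<cdot>\<^sub>m 1\<^sub>m n) A' (0\<^sub>m m n) (?x \<cdot>\<^sub>m 1\<^sub>m m - B' * A')"
    unfolding mult_four_block_mat[OF c(6,8,3,5) c(4,1,2,7)] using c
    by (intro cong_four_block_mat) (auto intro!: eq_matI)
  have LRM: "?M \<in> carrier_mat (n + m) (n + m)" "?R \<in> carrier_mat (n + m) (n + m)" "?L \<in> carrier_mat (n + m) (n + m)"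
    using c by auto
  have "det ?M * det ?R = det (?x \<cdot>\<^sub>m 1\<^sub>m n - A' * B') * det (1\<^sub>m m :: complex poly mat)"
    unfolding det_mult[OF LRM(1,2), symmetric] MR using c
    by (intro det_four_block_mat_lower_left_zero[of _ n _ m]) auto
  moreover have "det ?R = det (1\<^sub>m n :: complex poly mat) * det (1\<^sub>m m :: complex poly mat)"
    using c by (intro det_four_block_mat_upper_right_zero[of _ n _ m]) auto
  ultimately have 1: "det ?M = char_poly (A * B)"
    by (simp add: char[OF A B] A'_def B'_def)
  have "det ?L * det ?M = det (?x \<cdot>\<^sub>m 1\<^sub>m n :: complex poly mat) * det (?x \<cdot>\<^sub>m 1\<^sub>m m - B' * A')"
    unfolding det_mult[OF LRM(3,1), symmetric] LM using c
    by (intro det_four_block_mat_lower_left_zero[of _ n _ m]) auto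
  moreover have "det ?L = det (1\<^sub>m n :: complex poly mat) * det (?x \<cdot>\<^sub>m 1\<^sub>m m :: complex poly mat)"
    using c by (intro det_four_block_mat_upper_right_zero[of _ n _ m]) auto
  ultimately have "?x ^ m * det ?M = ?x ^ n * char_poly (B * A)"
    by (simp add: char[OF B A] A'_def B'_def)
  then show ?thesis unfolding 1 .
qed

text \<open>The two spectra differ only in the multiplicity of 0, and a zero eigenvalue contributes
  \<open>0 * ln 0 = 0\<close>.\<close>

lemma vn_entropy_mult_commute:
  assumes A: "A \<in> carrier_mat n m" and B: "B \<in> carrier_mat m n"
  shows "vn_entropy (A * B) = vn_entropy (B * A)"
proof -
  have "A * B \<in> carrier_mat n n" "B * A \<in> carrier_mat m m" using A B by auto
  then have nz: "char_poly (A * B) \<noteq> 0" "char_poly (B * A) \<noteq> 0"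
    using degree_monic_char_poly by (metis leading_coeff_0_iff zero_neq_one)+
  have "proots ([:0, 1:] ^ m * char_poly (A * B)) = proots ([:0, 1:] ^ n * char_poly (B * A))"
    by (simp only: char_poly_mult_commute[OF A B])
  then have "repeat_mset m {#0#} + proots (char_poly (A * B)) = repeat_mset n {#0#} + proots (char_poly (B * A))"
    using nz by (simp add: proots_mult proots_power)
  then have "(\<Sum>x\<in>#repeat_mset m {#0#} + proots (char_poly (A * B)). Re x * ln (Re x))
     = (\<Sum>x\<in>#repeat_mset n {#0#} + proots (char_poly (B * A)). Re x * ln (Re x))" by simp
  moreover have "(\<Sum>x\<in>#repeat_mset k {#0::complex#}. Re x * ln (Re x)) = 0" for k
    by (induction k) auto
  ultimately show ?thesis by (simp add: vn_entropy_def)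
qed

subsection \<open>Resolvent comparison for sums of logarithms\<close>

text \<open>Subtracting the total mass times \<open>ln t\<close> leaves the terms
  \<open>c i * ln (1 + x i / t)\<close>, each of which tends to 0.\<close>

lemma ln_shift_sum_tendsto:
  fixes c x :: "'i \<Rightarrow> real"
  assumes "finite I" "\<And>i. i \<in> I \<Longrightarrow> 0 \<le> x i"
  shows "((\<lambda>t. (\<Sum>i\<in>I. c i * ln (x i + t)) - (\<Sum>i\<in>I. c i) * ln t) \<longlongrightarrow> 0) at_top"
proof -
  have "((\<lambda>t. \<Sum>i\<in>I. c i * ln (1 + x i / t)) \<longlongrightarrow> (\<Sum>i\<in>I. c i * ln (1 + 0))) at_top"
    by (intro tendsto_intros tendsto_sum tendsto_divide_0[OF tendsto_const] filterlim_ident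
        filterlim_at_top_imp_at_infinity) auto
  then have "((\<lambda>t. \<Sum>i\<in>I. c i * ln (1 + x i / t)) \<longlongrightarrow> 0) at_top" by simp
  moreover have "\<forall>\<^sub>F t in at_top. (\<Sum>i\<in>I. c i * ln (1 + x i / t))
      = (\<Sum>i\<in>I. c i * ln (x i + t)) - (\<Sum>i\<in>I. c i) * ln t"
    using eventually_gt_at_top[of 0]
  proof eventually_elim
    case (elim t)
    have "ln (1 + x i / t) = ln (x i + t) - ln t" if "i \<in> I" for i
    proof -
      have "1 + x i / t = (x i + t) / t" using elim by (simp add: field_simps)
      then show ?thesis using elim assms(2)[OF that] by (simp add: ln_div)
    qed
    then show ?case
      by (simp add: right_diff_distrib sum_subtractf sum_distrib_right)
  qed
  ultimately show ?thesis by (rule Lim_transform_eventually)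
qed

text \<open>The logarithm is discontinuous at 0, but points with \<open>x i = 0\<close> carry no
  weight and drop out on both sides.\<close>

lemma ln_shift_sum_tendsto_at_right_0:
  fixes c x :: "'i \<Rightarrow> real"
  assumes "finite I" "\<And>i. i \<in> I \<Longrightarrow> 0 \<le> x i" "\<And>i. i \<in> I \<Longrightarrow> x i = 0 \<Longrightarrow> c i = 0"
  shows "((\<lambda>t. \<Sum>i\<in>I. c i * ln (x i + t)) \<longlongrightarrow> (\<Sum>i\<in>I. c i * ln (x i))) (at_right 0)"
proof (intro tendsto_sum)
  fix i assume i: "i \<in> I"
  show "((\<lambda>t. c i * ln (x i + t)) \<longlongrightarrow> c i * ln (x i)) (at_right 0)"
  proof (cases "x i = 0")
    case False
    have "((\<lambda>t. c i * ln (x i + t)) \<longlongrightarrow> c i * ln (x i + 0)) (at_right 0)"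
      using False by (intro tendsto_intros) auto
    then show ?thesis by simp
  qed (use assms(3)[OF i] in auto)
qed

text \<open>The sums of resolvents are the derivatives in \<open>t\<close> of the sums of shifted logarithms, whose
  difference vanishes at infinity since the weights have equal total mass.\<close>

lemma ln_sum_le_of_resolvent_le:
  fixes c x :: "'i \<Rightarrow> real" and c' x' :: "'j \<Rightarrow> real"
  assumes I: "finite I" "\<And>i. i \<in> I \<Longrightarrow> 0 \<le> x i" "\<And>i. i \<in> I \<Longrightarrow> x i = 0 \<Longrightarrow> c i = 0"
    and J: "finite J" "\<And>j. j \<in> J \<Longrightarrow> 0 \<le> x' j" "\<And>j. j \<in> J \<Longrightarrow> x' j = 0 \<Longrightarrow> c' j = 0"
    and mass: "(\<Sum>i\<in>I. c i) = (\<Sum>j\<in>J. c' j)"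
    and res: "\<And>t. t > 0 \<Longrightarrow> (\<Sum>j\<in>J. c' j / (x' j + t)) \<le> (\<Sum>i\<in>I. c i / (x i + t))"
  shows "(\<Sum>i\<in>I. c i * ln (x i)) \<le> (\<Sum>j\<in>J. c' j * ln (x' j))"
proof -
  define \<Phi> where "\<Phi> t = (\<Sum>i\<in>I. c i * ln (x i + t)) - (\<Sum>j\<in>J. c' j * ln (x' j + t))" for t
  have deriv: "(\<Phi> has_real_derivative
      (\<Sum>i\<in>I. c i / (x i + t)) - (\<Sum>j\<in>J. c' j / (x' j + t))) (at t)" if "t > 0" for t
    unfolding \<Phi>_def using I(2) J(2) that
    by (auto intro!: derivative_eq_intros DERIV_sum add_nonneg_pos simp: add_nonneg_pos)
  have mono: "\<Phi> s \<le> \<Phi> t" if "0 < s" "s \<le> t" for s t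
  proof (rule DERIV_nonneg_imp_nondecreasing[OF that(2)])
    fix y assume "s \<le> y" "y \<le> t"
    then show "\<exists>z. (\<Phi> has_real_derivative z) (at y) \<and> z \<ge> 0"
      using deriv[of y] res[of y] that by (intro exI[of _ "(\<Sum>i\<in>I. c i / (x i + y)) - (\<Sum>j\<in>J. c' j / (x' j + y))"]) auto
  qed
  have "(\<Phi> \<longlongrightarrow> 0) at_top"
    using tendsto_diff[OF ln_shift_sum_tendsto[OF I(1,2), where c=c] ln_shift_sum_tendsto[OF J(1,2), where c=c']]
    unfolding \<Phi>_def mass by simp
  \<comment> \<open>A nondecreasing function with limit 0 at infinity is nowhere positive; its right
    limit at 0 inherits the sign.\<close>
  then have "\<Phi> s \<le> 0" if "s > 0" for s
    using that mono
    by (intro tendsto_lowerbound[of \<Phi> _ at_top "\<Phi> s"]) (auto intro: eventually_mono[OF eventually_ge_at_top[of s]])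
  moreover have "(\<Phi> \<longlongrightarrow> (\<Sum>i\<in>I. c i * ln (x i)) - (\<Sum>j\<in>J. c' j * ln (x' j))) (at_right 0)"
    unfolding \<Phi>_def
    by (intro tendsto_diff ln_shift_sum_tendsto_at_right_0 I J)
  ultimately have "(\<Sum>i\<in>I. c i * ln (x i)) - (\<Sum>j\<in>J. c' j * ln (x' j)) \<le> 0"
    by (intro tendsto_upperbound[of \<Phi> _ "at_right 0"]) (auto simp: eventually_at_right_less
        intro: eventually_mono[OF eventually_at_right_less[of 0]])
  then show ?thesis by simp
qed

text \<open>Lagrange interpolation, in the form that a functional on \<open>{q j}\<close> is determined by its moments.\<close>

lemma moments_determine_sum:
  fixes q w :: "'i \<Rightarrow> real" and f :: "real \<Rightarrow> real"
  assumes fin: "finite J" and mom: "\<And>k. (\<Sum>j\<in>J. q j ^ k * w j) = 0"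
  shows "(\<Sum>j\<in>J. f (q j) * w j) = 0"
proof -
  have poly0: "(\<Sum>j\<in>J. poly p (q j) * w j) = 0" for p
  proof -
    have "(\<Sum>j\<in>J. poly p (q j) * w j) = (\<Sum>j\<in>J. \<Sum>k\<le>degree p. coeff p k * (q j ^ k * w j))"
      by (simp add: poly_altdef sum_distrib_right mult.assoc)
    also have "\<dots> = (\<Sum>k\<le>degree p. coeff p k * (\<Sum>j\<in>J. q j ^ k * w j))"
      by (subst sum.swap) (simp add: sum_distrib_left)
    finally show ?thesis by (simp add: mom)
  qed
  \<comment> \<open>The values \<open>q j\<close> may repeat, so the moments determine only the
    total weight of each level set. The polynomial \<open>p\<close> is a nonzero multiple of the
    Lagrange basis polynomial at \<open>v\<close>.\<close>
  have level: "(\<Sum>j\<in>{j\<in>J. q j = v}. w j) = 0" if "v \<in> q ` J" for v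
  proof -
    define p where "p = (\<Prod>u\<in>q ` J - {v}. [:- u, 1:])"
    have p0: "poly p (q j) = 0" if "j \<in> J" "q j \<noteq> v" for j
      using that fin by (auto simp: p_def poly_prod)
    have pv: "poly p v \<noteq> 0" using fin by (auto simp: p_def poly_prod)
    have "0 = (\<Sum>j\<in>J. poly p (q j) * w j)" by (simp add: poly0)
    also have "\<dots> = (\<Sum>j\<in>{j\<in>J. q j = v}. poly p (q j) * w j)"
      using fin p0 by (intro sum.mono_neutral_right) auto
    also have "\<dots> = poly p v * (\<Sum>j\<in>{j\<in>J. q j = v}. w j)"
      unfolding sum_distrib_left by (intro sum.cong) auto
    finally show ?thesis using pv by simp
  qed
  have "(\<Sum>j\<in>J. f (q j) * w j) = (\<Sum>v\<in>q ` J. \<Sum>j\<in>{j\<in>J. q j = v}. f (q j) * w j)"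
    using fin by (intro sum.group[symmetric]) auto
  also have "\<dots> = (\<Sum>v\<in>q ` J. f v * (\<Sum>j\<in>{j\<in>J. q j = v}. w j))"
    unfolding sum_distrib_left by (intro sum.cong) auto
  finally show ?thesis using level by simp
qed

subsection \<open>Monotonicity of the relative entropy\<close>

lemma mtrace_gram:
  assumes "Y \<in> carrier_mat n m"
  shows "mtrace (adj Y * Y) = of_real (\<Sum>i<m. \<Sum>j<n. (cmod (Y $$ (j, i)))\<^sup>2)"
  using assms
  by (subst mtrace_mult_sum[where n=m and m=n]) (auto simp: complex_norm_square mult.commute simp del: of_real_power intro!: sum.cong)

lemma mtrace_real_diag:
  assumes "Z \<in> carrier_mat n n"
  shows "mtrace (real_diag n d * Z) = (\<Sum>i<n. of_real (d i) * Z $$ (i, i))"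
  using assms
  by (subst mtrace_mult_sum[where n=n and m=n]) (auto simp: real_diag_def if_distrib if_distribR cong: if_cong)

lemma index_adj_mult:
  assumes "Y \<in> carrier_mat n m" "G \<in> carrier_mat n k" "i < m" "l < k"
  shows "(adj Y * G) $$ (i, l) = (\<Sum>j<n. cnj (Y $$ (j, i)) * G $$ (j, l))"
  using assms by (subst index_mult_sum[where n=m and m=n and k=k]) auto

text \<open>Positivity in the form in which it is used: the factor \<open>K\<close> is also a
  purification, its column index running over the purifying space.\<close>

definition gram :: "nat \<Rightarrow> complex mat \<Rightarrow> bool" where
  "gram n A \<longleftrightarrow> (\<exists>m K. K \<in> carrier_mat n m \<and> A = K * adj K)"

lemma gram_hermitian: "gram n A \<Longrightarrow> A \<in> carrier_mat n n \<and> adj A = A"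
  by (auto simp: gram_def adj_mult)

text \<open>By cyclicity the trace is the squared Frobenius norm of \<open>R * K\<close>.\<close>

lemma gram_mtrace_nonneg:
  assumes "gram n A" "R \<in> carrier_mat k n"
  shows "0 \<le> Re (mtrace (A * (adj R * R)))"
proof -
  obtain m K where K: "K \<in> carrier_mat n m" "A = K * adj K" using assms(1) by (auto simp: gram_def)
  have "mtrace (K * (adj K * (adj R * R))) = mtrace (adj K * (adj R * R) * K)"
    using K assms(2) by (intro mtrace_comm[where n=n and m=m]) auto
  also have "adj K * (adj R * R) * K = adj (R * K) * (R * K)"
    using K assms(2) by (simp add: adj_mult mult_assoc_dim)
  finally show ?thesis
    using K assms(2) mtrace_gram[of "R * K" k m] by (simp add: mult_assoc_dim sum_nonneg)
qed

lemma unitary_diag_entry: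
  assumes "unitary n U" "i < n"
  shows "(adj U * (U * real_diag n d * adj U) * U) $$ (i, i) = of_real (d i)"
  using assms unitaryD[OF assms(1)] by (simp add: mult_assoc_dim right_mult_one_dim) (simp add: real_diag_def)

text \<open>\<open>d i\<close> is the squared norm of column \<open>i\<close> of
  \<open>adj K * U\<close>.\<close>

lemma gram_eigenvalue_nonneg:
  assumes "gram n A" "unitary n U" "A = U * real_diag n d * adj U" "i < n"
  shows "0 \<le> d i"
proof -
  obtain m K where K: "K \<in> carrier_mat n m" "A = K * adj K" using assms(1) by (auto simp: gram_def)
  note U = unitaryD[OF assms(2)]
  let ?Y = "adj K * U"
  have Y: "?Y \<in> carrier_mat m n" using K U by auto
  have "of_real (d i) = (adj U * A * U) $$ (i, i)"
    using unitary_diag_entry[OF assms(2,4)] assms(3) by simp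
  also have "adj U * A * U = adj ?Y * ?Y"
    using K U by (simp add: adj_mult mult_assoc_dim)
  also have "\<dots> $$ (i, i) = (\<Sum>j<m. cnj (?Y $$ (j, i)) * ?Y $$ (j, i))"
    using Y assms(4) by (intro index_adj_mult) auto
  also have "\<dots> = of_real (\<Sum>j<m. (cmod (?Y $$ (j, i)))\<^sup>2)"
    by (simp only: complex_norm_square of_real_sum mult.commute)
  finally have "d i = (\<Sum>j<m. (cmod (?Y $$ (j, i)))\<^sup>2)" using of_real_eq_iff by blast
  then show ?thesis by (simp add: sum_nonneg)
qed

lemma gram_of_diag:
  assumes U: "unitary n U" and "\<And>i. i < n \<Longrightarrow> 0 \<le> d i"
  shows "gram n (U * real_diag n d * adj U)"
proof -
  let ?S = "real_diag n (\<lambda>i. sqrt (d i))"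
  note U' = unitaryD[OF U]
  have "?S * adj ?S = real_diag n d"
  proof (rule eq_matI)
    fix i j assume "i < dim_row (real_diag n d)" "j < dim_col (real_diag n d)"
    then have ij: "i < n" "j < n" by auto
    have "(?S * adj ?S) $$ (i, j) = (\<Sum>l<n. ?S $$ (i, l) * adj ?S $$ (l, j))"
      using ij by (intro index_mult_sum[where n=n and m=n and k=n]) auto
    also have "\<dots> = (\<Sum>l<n. if l = i then real_diag n d $$ (i, j) else 0)"
      using ij assms(2) by (intro sum.cong) (auto simp: real_diag_def simp flip: of_real_mult)
    finally show "(?S * adj ?S) $$ (i, j) = real_diag n d $$ (i, j)" using ij by simp
  qed auto
  then have "U * real_diag n d * adj U = (U * ?S) * adj (U * ?S)"
    using U' by (simp add: adj_mult flip: mult_assoc_dim) (simp add: mult_assoc_dim)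
  then show ?thesis unfolding gram_def using U' by (intro exI[of _ n] exI[of _ "U * ?S"]) auto
qed

text \<open>Testing positivity on the columns of a diagonalizing unitary shows that the eigenvalues
  are nonnegative, so their square roots give a factor.\<close>

lemma psd_gram:
  assumes "psd n A"
  shows "gram n A"
proof -
  have A: "A \<in> carrier_mat n n" "adj A = A" using assms by (auto simp: psd_def)
  obtain U d where U: "unitary n U" and AU: "A = U * real_diag n d * adj U"
    using hermitian_diagonalization[OF A] by blast
  note U' = unitaryD[OF U]
  have d: "0 \<le> d i" if i: "i < n" for i
  proof -
    have c: "col U i \<in> carrier_vec n" using U' by auto
    have "of_real (d i) = (adj U * A * U) $$ (i, i)"
      using unitary_diag_entry[OF U i] AU by simp
    also have "\<dots> = (adj U * (A * U)) $$ (i, i)" using A U' by (simp add: mult_assoc_dim)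
    also have "\<dots> = (\<Sum>j<n. cnj (U $$ (j, i)) * (A * U) $$ (j, i))"
      using A U' i by (intro index_adj_mult) auto
    also have "\<dots> = (\<Sum>j<n. cnj (col U i $ j) * (A *\<^sub>v col U i) $ j)"
      using A U' i by (intro sum.cong) auto
    finally have "d i = Re (\<Sum>j<n. cnj (col U i $ j) * (A *\<^sub>v col U i) $ j)"
      by (metis Re_complex_of_real)
    then show ?thesis using assms c unfolding psd_def by metis
  qed
  show ?thesis unfolding AU using d by (intro gram_of_diag U)
qed

text \<open>For positive definite \<rho> and \<sigma> the maximizer solves \<sigma> X + t X \<rho> =
  \<rho>. The maximum is then the resolvent at -t of the relative modular operator, which sends A to
  \<sigma> A times the inverse of \<rho>, evaluated in the vector given by the square root of
  \<rho>.\<close>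

definition rel_form :: "complex mat \<Rightarrow> complex mat \<Rightarrow> real \<Rightarrow> complex mat \<Rightarrow> real" where
  "rel_form \<rho> \<sigma> t X = 2 * Re (mtrace (\<rho> * adj X)) - Re (mtrace (\<sigma> * (X * adj X)))
     - t * Re (mtrace (\<rho> * (adj X * X)))"

text \<open>\<open>Y\<close> holds the coordinates of the argument in the rank-one operators built
  from an eigenvector of \<sigma> and one of \<rho>. These diagonalize both quadratic terms, so one
  scalar problem remains for each pair; \<open>G\<close> holds the overlaps of the
  eigenvectors.\<close>

lemma rel_form_coordinates:
  assumes U: "unitary n U" and W: "unitary n W" and Y: "Y \<in> carrier_mat n n"
  defines "G \<equiv> adj W * U"
  shows "rel_form (U * real_diag n p * adj U) (W * real_diag n q * adj W) t (W * Y * adj U) =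
    (\<Sum>j<n. \<Sum>i<n. 2 * p i * Re (G $$ (j, i) * cnj (Y $$ (j, i))) - (q j + t * p i) * (cmod (Y $$ (j, i)))\<^sup>2)"
proof -
  note u = unitaryD[OF U] and w = unitaryD[OF W]
  have dY: "dim_row Y = n" "dim_col Y = n" using Y by auto
  have G: "G \<in> carrier_mat n n" using u w by (auto simp: G_def)
  let ?P = "real_diag n p" and ?Q = "real_diag n q"
  let ?X = "W * Y * adj U"
  have "mtrace ((U * ?P * adj U) * adj ?X) = mtrace (U * (?P * (adj Y * adj W)))"
    using u w dY by (simp add: adj_mult mult_assoc_dim)
  also have "\<dots> = mtrace (?P * (adj Y * adj W) * U)"
    using u w Y by (intro mtrace_comm[where n=n and m=n]) auto
  also have "\<dots> = mtrace (?P * (adj Y * G))"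
    using u w dY by (simp add: G_def mult_assoc_dim)
  also have "\<dots> = (\<Sum>i<n. of_real (p i) * (\<Sum>j<n. cnj (Y $$ (j, i)) * G $$ (j, i)))"
    using Y G by (subst mtrace_real_diag) (auto intro!: sum.cong simp: index_adj_mult simp del: index_mult_mat(1))
  also have "Re \<dots> = (\<Sum>i<n. \<Sum>j<n. p i * Re (G $$ (j, i) * cnj (Y $$ (j, i))))"
    unfolding sum_distrib_left Re_sum by (intro sum.cong) (auto simp: algebra_simps)
  finally have 1: "Re (mtrace ((U * ?P * adj U) * adj ?X))
    = (\<Sum>j<n. \<Sum>i<n. p i * Re (G $$ (j, i) * cnj (Y $$ (j, i))))"
    by (subst sum.swap)
  have "mtrace ((W * ?Q * adj W) * (?X * adj ?X)) = mtrace (W * (?Q * (Y * (adj Y * adj W))))"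
    using u w dY by (simp add: adj_mult mult_assoc_dim)
  also have "\<dots> = mtrace (?Q * (Y * (adj Y * adj W)) * W)"
    using u w Y by (intro mtrace_comm[where n=n and m=n]) auto
  also have "\<dots> = mtrace (?Q * (adj (adj Y) * adj Y))"
    using u w dY by (simp add: mult_assoc_dim right_mult_one_dim)
  also have "\<dots> = (\<Sum>j<n. of_real (q j) * (\<Sum>i<n. cnj (adj Y $$ (i, j)) * adj Y $$ (i, j)))"
    using Y by (subst mtrace_real_diag) (auto intro!: sum.cong simp: index_adj_mult[where n=n and m=n and k=n] simp del: index_mult_mat(1) adj_adj)
  also have "\<dots> = (\<Sum>j<n. \<Sum>i<n. of_real (q j * (cmod (Y $$ (j, i)))\<^sup>2))"
    unfolding sum_distrib_left using dY by (intro sum.cong) (auto simp: complex_norm_square simp flip: of_real_power)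
  finally have 2: "Re (mtrace ((W * ?Q * adj W) * (?X * adj ?X))) = (\<Sum>j<n. \<Sum>i<n. q j * (cmod (Y $$ (j, i)))\<^sup>2)"
    by (simp add: Re_sum)
  have "mtrace ((U * ?P * adj U) * (adj ?X * ?X)) = mtrace (U * (?P * (adj Y * (Y * adj U))))"
    using u w dY by (simp add: adj_mult mult_assoc_dim)
  also have "\<dots> = mtrace (?P * (adj Y * (Y * adj U)) * U)"
    using u w Y by (intro mtrace_comm[where n=n and m=n]) auto
  also have "\<dots> = mtrace (?P * (adj Y * Y))"
    using u w dY by (simp add: mult_assoc_dim right_mult_one_dim)
  also have "\<dots> = (\<Sum>i<n. of_real (p i) * (\<Sum>j<n. cnj (Y $$ (j, i)) * Y $$ (j, i)))"
    using Y by (subst mtrace_real_diag) (auto intro!: sum.cong simp: index_adj_mult simp del: index_mult_mat(1))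
  also have "\<dots> = (\<Sum>i<n. \<Sum>j<n. of_real (p i * (cmod (Y $$ (j, i)))\<^sup>2))"
    unfolding sum_distrib_left using dY by (intro sum.cong) (auto simp: complex_norm_square simp flip: of_real_power)
  finally have 3: "Re (mtrace ((U * ?P * adj U) * (adj ?X * ?X))) = (\<Sum>j<n. \<Sum>i<n. p i * (cmod (Y $$ (j, i)))\<^sup>2)"
    by (subst sum.swap) (simp add: Re_sum)
  show ?thesis unfolding rel_form_def 1 2 3
    by (simp add: sum_distrib_left sum.distrib sum_subtractf algebra_simps)
qed

text \<open>Equality of moments is all that is needed of \<open>\<sigma> = E \<rho>\<close>: by interpolation it gives
  \<open>tr(\<rho> f(\<sigma>)) = tr(\<sigma> f(\<sigma>))\<close> for every function \<open>f\<close>.\<close>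

definition pinched :: "nat \<Rightarrow> complex mat \<Rightarrow> complex mat \<Rightarrow> bool" where
  "pinched n \<rho> \<sigma> \<longleftrightarrow> gram n \<rho> \<and> \<sigma> \<in> carrier_mat n n \<and> adj \<sigma> = \<sigma> \<and>
     (\<forall>k. mtrace (\<rho> * \<sigma> ^\<^sub>m k) = mtrace (\<sigma> * \<sigma> ^\<^sub>m k))"

lemma real_diag_mult: "real_diag n a * real_diag n b = real_diag n (\<lambda>i. a i * b i)"
proof (rule eq_matI)
  fix i j assume "i < dim_row (real_diag n (\<lambda>i. a i * b i))" "j < dim_col (real_diag n (\<lambda>i. a i * b i))"
  then have ij: "i < n" "j < n" by auto
  have "(real_diag n a * real_diag n b) $$ (i, j) = (\<Sum>l<n. real_diag n a $$ (i, l) * real_diag n b $$ (l, j))"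
    using ij by (intro index_mult_sum) auto
  also have "\<dots> = (\<Sum>l<n. if l = i then real_diag n (\<lambda>i. a i * b i) $$ (i, j) else 0)"
    using ij by (intro sum.cong) (auto simp: real_diag_def)
  finally show "(real_diag n a * real_diag n b) $$ (i, j) = real_diag n (\<lambda>i. a i * b i) $$ (i, j)"
    using ij by simp
qed auto

lemma unitary_diag_power:
  assumes "unitary n W"
  shows "(W * real_diag n q * adj W) ^\<^sub>m k = W * real_diag n (\<lambda>j. q j ^ k) * adj W"
proof (induction k)
  case 0
  have "real_diag n (\<lambda>j. q j ^ 0) = 1\<^sub>m n" by (rule eq_matI) (auto simp: real_diag_def)
  then show ?case using unitaryD[OF assms] by (simp add: right_mult_one_dim)
next
  case (Suc k)
  have "W * real_diag n (\<lambda>j. q j ^ k) * adj W * (W * real_diag n q * adj W)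
      = W * (real_diag n (\<lambda>j. q j ^ k) * real_diag n q) * adj W"
    using unitaryD[OF assms] by (simp add: mult_assoc_dim)
  then show ?case by (simp add: Suc real_diag_mult mult.commute)
qed

text \<open>The inner sum is the \<open>j\<close>-th diagonal entry of the first factor in the
  eigenbasis of the second.\<close>

lemma mtrace_unitary_diag_mult:
  assumes U: "unitary n U" and W: "unitary n W"
  shows "mtrace ((U * real_diag n p * adj U) * (W * real_diag n f * adj W))
    = of_real (\<Sum>j<n. f j * (\<Sum>i<n. (cmod ((adj W * U) $$ (j, i)))\<^sup>2 * p i))"
proof -
  note u = unitaryD[OF U] and w = unitaryD[OF W]
  let ?G = "adj W * U"
  have G: "adj ?G \<in> carrier_mat n n" using u w by auto
  have "mtrace ((U * real_diag n p * adj U) * (W * real_diag n f * adj W))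
      = mtrace (((U * real_diag n p * adj U) * (W * real_diag n f)) * adj W)"
    using u w by (simp add: mult_assoc_dim)
  also have "\<dots> = mtrace (adj W * ((U * real_diag n p * adj U) * (W * real_diag n f)))"
    using u w by (intro mtrace_comm[where n=n and m=n]) auto
  also have "\<dots> = mtrace ((adj W * (U * real_diag n p * adj U) * W) * real_diag n f)"
    using u w by (simp add: mult_assoc_dim)
  also have "\<dots> = mtrace (real_diag n f * (adj W * (U * real_diag n p * adj U) * W))"
    using u w by (intro mtrace_comm[where n=n and m=n]) auto
  also have "adj W * (U * real_diag n p * adj U) * W = adj (adj ?G) * (real_diag n p * adj ?G)"
    using u w by (simp add: adj_mult mult_assoc_dim)
  also have "mtrace (real_diag n f * \<dots>) =
      (\<Sum>j<n. of_real (f j) * (\<Sum>i<n. cnj (adj ?G $$ (i, j)) * (real_diag n p * adj ?G) $$ (i, j)))"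
    using G by (subst mtrace_real_diag)
      (auto intro!: sum.cong mult_carrier_mat[of _ n n] index_adj_mult[where n=n and m=n and k=n] simp del: index_mult_mat(1) adj_adj)
  also have "\<dots> = (\<Sum>j<n. of_real (f j) * (\<Sum>i<n. of_real ((cmod (?G $$ (j, i)))\<^sup>2 * p i)))"
  proof (intro sum.cong refl arg_cong2[of _ _ _ _ "(*)"])
    fix i j assume ij: "j \<in> {..<n}" "i \<in> {..<n}"
    have "(real_diag n p * adj ?G) $$ (i, j) = (\<Sum>l<n. real_diag n p $$ (i, l) * adj ?G $$ (l, j))"
      using ij G by (intro index_mult_sum) auto
    also have "\<dots> = (\<Sum>l<n. if l = i then of_real (p i) * adj ?G $$ (i, j) else 0)"
      using ij by (intro sum.cong) (auto simp: real_diag_def)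
    finally have "(real_diag n p * adj ?G) $$ (i, j) = of_real (p i) * cnj (?G $$ (j, i))"
      using ij u w by (simp del: index_mult_mat(1))
    moreover have "cnj (adj ?G $$ (i, j)) = ?G $$ (j, i)" using ij u w by (simp del: index_mult_mat(1))
    ultimately show "cnj (adj ?G $$ (i, j)) * (real_diag n p * adj ?G) $$ (i, j)
        = of_real ((cmod (?G $$ (j, i)))\<^sup>2 * p i)"
      by (simp add: complex_norm_square algebra_simps del: of_real_power)
  qed
  finally show ?thesis by simp
qed

lemma unitary_row_col_norm:
  assumes "unitary n G"
  shows "i < n \<Longrightarrow> (\<Sum>j<n. (cmod (G $$ (j, i)))\<^sup>2) = 1"
    and "j < n \<Longrightarrow> (\<Sum>i<n. (cmod (G $$ (j, i)))\<^sup>2) = 1"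
proof -
  have *: "(\<Sum>j<n. (cmod (G $$ (j, i)))\<^sup>2) = 1" if "unitary n G" "i < n" for G i
  proof -
    note g = unitaryD[OF that(1)]
    have "1 = (adj G * G) $$ (i, i)" using g that by simp
    also have "\<dots> = (\<Sum>j<n. cnj (G $$ (j, i)) * G $$ (j, i))"
      using g that by (intro index_adj_mult) auto
    also have "\<dots> = of_real (\<Sum>j<n. (cmod (G $$ (j, i)))\<^sup>2)"
      by (simp add: complex_norm_square mult.commute del: of_real_power)
    finally show ?thesis by (metis of_real_eq_1_iff)
  qed
  show "i < n \<Longrightarrow> (\<Sum>j<n. (cmod (G $$ (j, i)))\<^sup>2) = 1" using *[OF assms] .
  assume j: "j < n"
  have "(\<Sum>i<n. (cmod (G $$ (j, i)))\<^sup>2) = (\<Sum>i<n. (cmod (adj G $$ (i, j)))\<^sup>2)"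
    using j unitaryD[OF assms] by (intro sum.cong) auto
  then show "(\<Sum>i<n. (cmod (G $$ (j, i)))\<^sup>2) = 1" using *[OF unitary_adj[OF assms] j] by simp
qed

text \<open>Complete the square: with \<open>a = q + t * p\<close>, the gap in the inequality times
  \<open>a\<close> is the squared modulus of \<open>a * y - p * g\<close>. For \<open>p = 0\<close>
  the right side is 0, by division by zero inside and the factor \<open>p\<close> outside, and the
  left side is at most 0.\<close>

lemma quadratic_form_max:
  fixes g y :: complex and p q t :: real
  assumes "0 \<le> p" "0 \<le> q" "0 < t"
  shows "2 * p * Re (g * cnj y) - (q + t * p) * (cmod y)\<^sup>2 \<le> (cmod g)\<^sup>2 * p / (q / p + t)"
    and "y = g * of_real (p / (q + t * p)) \<Longrightarrow>
      2 * p * Re (g * cnj y) - (q + t * p) * (cmod y)\<^sup>2 = (cmod g)\<^sup>2 * p / (q / p + t)"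
proof -
  define a where "a = q + t * p"
  have eq: "(cmod g)\<^sup>2 * p / (q / p + t) = (cmod g)\<^sup>2 * p\<^sup>2 / a"
    using assms by (cases "p = 0") (auto simp: a_def field_simps power2_eq_square)
  have a: "p = 0 \<or> a > 0" "a \<ge> 0"
    using assms by (cases "p = 0"; simp add: a_def add_nonneg_pos)+
  show "2 * p * Re (g * cnj y) - (q + t * p) * (cmod y)\<^sup>2 \<le> (cmod g)\<^sup>2 * p / (q / p + t)"
  proof (cases "p = 0")
    case False
    then have a0: "a > 0" using a by simp
    have "0 \<le> (cmod (of_real a * y - of_real p * g))\<^sup>2" by simp
    also have "\<dots> = a\<^sup>2 * (cmod y)\<^sup>2 - 2 * a * p * Re (g * cnj y) + p\<^sup>2 * (cmod g)\<^sup>2"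
      unfolding cmod_power2 by (simp add: power2_eq_square algebra_simps)
    finally have "a * (2 * p * Re (g * cnj y) - a * (cmod y)\<^sup>2) \<le> p\<^sup>2 * (cmod g)\<^sup>2"
      by (simp add: power2_eq_square algebra_simps)
    then show ?thesis unfolding eq a_def[symmetric] using a0 by (simp add: pos_le_divide_eq mult.commute)
  qed (use assms in auto)
  assume y: "y = g * of_real (p / (q + t * p))"
  have "Re (g * cnj (g * of_real s)) = (cmod g)\<^sup>2 * s" "(cmod (g * of_real s))\<^sup>2 = (cmod g)\<^sup>2 * s\<^sup>2" for s
    unfolding cmod_power2 by (simp_all add: power2_eq_square algebra_simps)
  then have "Re (g * cnj y) = (cmod g)\<^sup>2 * (p / a)" "(cmod y)\<^sup>2 = (cmod g)\<^sup>2 * (p / a)\<^sup>2"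
    unfolding y a_def[symmetric] by blast+
  moreover have "2 * p * (N * (p / a)) - a * (N * (p / a)\<^sup>2) = N * p\<^sup>2 / a" for N
    using a by (cases "p = 0") (auto simp: power2_eq_square field_simps)
  ultimately show "2 * p * Re (g * cnj y) - (q + t * p) * (cmod y)\<^sup>2 = (cmod g)\<^sup>2 * p / (q / p + t)"
    unfolding eq a_def[symmetric] by (simp only:)
qed

text \<open>\<open>r\<close> is the diagonal of \<rho> in the eigenbasis of \<sigma>. The moment
  identities say that \<open>r\<close> and \<open>q\<close> agree when tested against powers of
  \<open>q\<close>, and interpolation extends this to every function of \<open>q\<close>.\<close>

lemma pinched_moments:
  assumes "pinched n \<rho> \<sigma>" and U: "unitary n U" and \<rho>U: "\<rho> = U * real_diag n p * adj U"
    and W: "unitary n W" and \<sigma>W: "\<sigma> = W * real_diag n q * adj W"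
  defines "r j \<equiv> \<Sum>i<n. (cmod ((adj W * U) $$ (j, i)))\<^sup>2 * p i"
  shows pinched_moments_eq: "(\<Sum>j<n. f (q j) * (r j - q j)) = 0"
    and pinched_eigenvalue_nonneg: "j < n \<Longrightarrow> 0 \<le> q j"
proof -
  note w = unitaryD[OF W]
  have mom: "\<And>k. mtrace (\<rho> * \<sigma> ^\<^sub>m k) = mtrace (\<sigma> * \<sigma> ^\<^sub>m k)" and \<rho>: "gram n \<rho>"
    using assms(1) by (auto simp: pinched_def)
  have p0: "0 \<le> p i" if "i < n" for i using gram_eigenvalue_nonneg[OF \<rho> U \<rho>U that] .
  have r0: "0 \<le> r j" for j unfolding r_def by (intro sum_nonneg mult_nonneg_nonneg p0) auto
  have mom0: "(\<Sum>j<n. q j ^ k * (r j - q j)) = 0" for k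
  proof -
    have "mtrace (\<rho> * \<sigma> ^\<^sub>m k) = of_real (\<Sum>j<n. q j ^ k * r j)"
      unfolding \<rho>U \<sigma>W unitary_diag_power[OF W] mtrace_unitary_diag_mult[OF U W]
      by (simp add: r_def)
    moreover have "mtrace (\<sigma> * \<sigma> ^\<^sub>m k) = of_real (\<Sum>j<n. q j ^ k * q j)"
    proof -
      have "(\<Sum>i<n. (cmod ((adj W * W) $$ (j, i)))\<^sup>2 * q i) = q j" if "j < n" for j
      proof -
        have "(\<Sum>i<n. (cmod ((adj W * W) $$ (j, i)))\<^sup>2 * q i) = (\<Sum>i<n. if i = j then q j else 0)"
          unfolding w(4) using that by (intro sum.cong) auto
        then show ?thesis using that by simp
      qed
      then show ?thesis
        unfolding \<sigma>W unitary_diag_power[OF W] mtrace_unitary_diag_mult[OF W W] by simp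
    qed
    ultimately have "(\<Sum>j<n. q j ^ k * r j) = (\<Sum>j<n. q j ^ k * q j)" using mom[of k] of_real_eq_iff by metis
    then show ?thesis by (simp add: right_diff_distrib sum_subtractf)
  qed
  have fq: "(\<Sum>j<n. f (q j) * (r j - q j)) = 0" for f
    by (rule moments_determine_sum[of "{..<n}" q "\<lambda>j. r j - q j" f, OF finite_lessThan mom0])
  show "(\<Sum>j<n. f (q j) * (r j - q j)) = 0" by (rule fq)
  show "0 \<le> q j" if j: "j < n" for j
  proof -
    \<comment> \<open>With \<open>f\<close> the indicator of this eigenvalue, \<open>card ?J\<close>
      times \<open>q j\<close> becomes a sum of entries of \<open>r\<close>, which are
      nonnegative.\<close>
    let ?J = "{i\<in>{..<n}. q i = q j}"
    have "(\<Sum>i<n. (if q i = q j then 1 else 0) * (r i - q i)) = (\<Sum>i\<in>?J. r i - q i)"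
      by (subst sum.inter_filter) (auto intro!: sum.cong)
    then have "(\<Sum>i\<in>?J. r i) = (\<Sum>i\<in>?J. q i)"
      using fq[of "\<lambda>y. if y = q j then 1 else 0"] by (simp add: sum_subtractf)
    also have "\<dots> = card ?J * q j" by simp
    finally have "0 \<le> card ?J * q j" using sum_nonneg[of ?J r] r0 by simp
    moreover have "card ?J > 0" using j by (auto simp: card_gt_0_iff)
    ultimately show ?thesis using mult_pos_neg[of "real (card ?J)" "q j"] by fastforce
  qed
qed

text \<open>\<open>x\<close> lists the eigenvalues \<open>q j / p i\<close> of the relative modular
  operator and \<open>c\<close> the weights given to them by \<rho>. Thus the sum of
  \<open>c z * ln (x z)\<close> is minus the relative entropy, and the sum of
  \<open>c z / (x z + t)\<close> is the maximum of \<open>rel_form\<close>.\<close>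

lemma pinched_spectral:
  assumes "pinched n \<rho> \<sigma>"
  shows "\<exists>c x :: nat \<times> nat \<Rightarrow> real.
    (\<forall>z\<in>{..<n} \<times> {..<n}. 0 \<le> x z \<and> (x z = 0 \<longrightarrow> c z = 0)) \<and>
    (\<Sum>z\<in>{..<n} \<times> {..<n}. c z) = Re (mtrace \<rho>) \<and>
    (\<Sum>z\<in>{..<n} \<times> {..<n}. c z * ln (x z)) = vn_entropy \<rho> - vn_entropy \<sigma> \<and>
    (\<forall>t>0. (\<forall>X\<in>carrier_mat n n. rel_form \<rho> \<sigma> t X \<le> (\<Sum>z\<in>{..<n} \<times> {..<n}. c z / (x z + t))) \<and>
      (\<exists>X\<in>carrier_mat n n. rel_form \<rho> \<sigma> t X = (\<Sum>z\<in>{..<n} \<times> {..<n}. c z / (x z + t))))"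
proof -
  have \<rho>: "gram n \<rho>" and \<sigma>: "\<sigma> \<in> carrier_mat n n" "adj \<sigma> = \<sigma>"
    using assms by (auto simp: pinched_def)
  obtain U p where U: "unitary n U" and \<rho>U: "\<rho> = U * real_diag n p * adj U"
    using hermitian_diagonalization gram_hermitian[OF \<rho>] by blast
  obtain W q where W: "unitary n W" and \<sigma>W: "\<sigma> = W * real_diag n q * adj W"
    using hermitian_diagonalization[OF \<sigma>] by blast
  note u = unitaryD[OF U] and w = unitaryD[OF W]
  define G where "G = adj W * U"
  have G: "unitary n G" unfolding G_def by (intro unitary_mult unitary_adj U W)
  define m where "m j i = (cmod (G $$ (j, i)))\<^sup>2" for j i
  define r where "r j = (\<Sum>i<n. m j i * p i)" for j
  have m0: "0 \<le> m j i" for j i by (simp add: m_def)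
  have msum: "i < n \<Longrightarrow> (\<Sum>j<n. m j i) = 1" for i
    using unitary_row_col_norm(1)[OF G] by (simp add: m_def)
  have p0: "0 \<le> p i" if "i < n" for i using gram_eigenvalue_nonneg[OF \<rho> U \<rho>U that] .
  have r0: "0 \<le> r j" for j unfolding r_def by (intro sum_nonneg mult_nonneg_nonneg m0 p0) auto
  have fq: "(\<Sum>j<n. f (q j) * (r j - q j)) = 0" for f
    using pinched_moments_eq[OF assms U \<rho>U W \<sigma>W] by (simp add: r_def m_def G_def)
  have q0: "0 \<le> q j" if "j < n" for j
    using pinched_eigenvalue_nonneg[OF assms U \<rho>U W \<sigma>W that] .
  \<comment> \<open>The indicator of 0 shows that \<open>r\<close> vanishes on the kernel of
    \<sigma>: the support of \<rho> lies in that of \<sigma>, which makes the relative entropy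
    finite.\<close>
  have supp: "m j i * p i = 0" if "j < n" "i < n" "q j = 0" for j i
  proof -
    have "(\<Sum>k<n. (if q k = 0 then 1 else 0) * (r k - q k)) = (\<Sum>k<n. if q k = 0 then r k else 0)"
      by (intro sum.cong) auto
    then have "(\<Sum>k<n. if q k = 0 then r k else 0) = 0"
      using fq[of "\<lambda>y. if y = 0 then 1 else 0"] by simp
    then have "(if q j = 0 then r j else 0) = 0"
      using sum_nonneg_0[of "{..<n}" "\<lambda>k. if q k = 0 then r k else 0" j] r0 that by simp
    then have "(\<Sum>i<n. m j i * p i) = 0" using that by (simp add: r_def)
    then show ?thesis
      using sum_nonneg_0[of "{..<n}" "\<lambda>i. m j i * p i" i] m0 p0 that by simp
  qed
  let ?I = "{..<n} \<times> {..<n}"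
  define c where "c = (\<lambda>(j, i). m j i * p i)"
  \<comment> \<open>Where \<open>p i = 0\<close> the quotient is 0 by convention; this is harmless,
    as \<open>c\<close> vanishes there.\<close>
  define x where "x = (\<lambda>(j, i). q j / p i)"
  show ?thesis
  proof (rule exI[of _ c], rule exI[of _ x], intro conjI ballI impI allI)
    show "0 \<le> x z" if "z \<in> ?I" for z using that p0 q0 by (auto simp: x_def)
    show "c z = 0" if "z \<in> ?I" "x z = 0" for z
      using that supp[of "fst z" "snd z"] by (auto simp: x_def c_def)
    have "mtrace \<rho> = mtrace ((U * real_diag n p) * adj U)" by (simp add: \<rho>U)
    also have "\<dots> = mtrace (adj U * (U * real_diag n p))"
      using u by (intro mtrace_comm[where n=n and m=n]) auto
    also have "\<dots> = of_real (\<Sum>i<n. p i)" using u by (simp add: mtrace_def real_diag_def)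
    finally have tr: "Re (mtrace \<rho>) = (\<Sum>i<n. p i)" by simp
    have "(\<Sum>z\<in>?I. c z) = (\<Sum>j<n. \<Sum>i<n. m j i * p i)"
      unfolding sum.cartesian_product by (simp add: c_def)
    also have "\<dots> = (\<Sum>i<n. \<Sum>j<n. m j i * p i)" by (rule sum.swap)
    also have "\<dots> = (\<Sum>i<n. p i)" using msum by (simp flip: sum_distrib_right)
    finally show "(\<Sum>z\<in>?I. c z) = Re (mtrace \<rho>)" unfolding tr .
    have ln_div_eq: "m j i * p i * ln (q j / p i) = m j i * p i * (ln (q j) - ln (p i))" if "j < n" "i < n" for j i
    proof (cases "m j i * p i = 0")
      case False
      then have "q j \<noteq> 0" "p i \<noteq> 0" using supp[OF that] by auto
      then have "q j > 0" "p i > 0" using p0[OF that(2)] q0[OF that(1)] by auto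
      then show ?thesis by (simp add: ln_div)
    qed simp
    have "(\<Sum>z\<in>?I. c z * ln (x z)) = (\<Sum>j<n. \<Sum>i<n. m j i * p i * (ln (q j) - ln (p i)))"
      unfolding sum.cartesian_product by (intro sum.cong) (auto simp: c_def x_def ln_div_eq)
    also have "\<dots> = (\<Sum>j<n. ln (q j) * r j) - (\<Sum>i<n. (\<Sum>j<n. m j i) * (p i * ln (p i)))"
      unfolding r_def sum_distrib_left sum_distrib_right
      by (subst (3) sum.swap) (simp add: sum_subtractf algebra_simps)
    \<comment> \<open>The case \<open>f = ln\<close>, that is, equality of the traces of \<rho> ln
      \<sigma> and \<sigma> ln \<sigma>; it turns the relative entropy into a difference of
      entropies.\<close>
    also have "(\<Sum>j<n. ln (q j) * r j) = (\<Sum>j<n. q j * ln (q j))"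
      using fq[of ln] by (simp add: right_diff_distrib sum_subtractf mult.commute)
    finally show "(\<Sum>z\<in>?I. c z * ln (x z)) = vn_entropy \<rho> - vn_entropy \<sigma>"
      using vn_entropy_unitary_diag[OF U \<rho>U] vn_entropy_unitary_diag[OF W \<sigma>W] msum by simp
    fix t :: real assume t: "t > 0"
    have sum_eq: "(\<Sum>z\<in>?I. c z / (x z + t)) = (\<Sum>j<n. \<Sum>i<n. m j i * p i / (q j / p i + t))"
      unfolding sum.cartesian_product by (intro sum.cong) (auto simp: c_def x_def)
    show "rel_form \<rho> \<sigma> t X \<le> (\<Sum>z\<in>?I. c z / (x z + t))" if X: "X \<in> carrier_mat n n" for X
    proof -
      have "X = W * (adj W * X * U) * adj U" using u w X by (simp add: mult_assoc_dim right_mult_one_dim)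
      moreover have "adj W * X * U \<in> carrier_mat n n" using u w X by auto
      ultimately obtain Y where Y: "Y \<in> carrier_mat n n" "X = W * Y * adj U" by blast
      show ?thesis unfolding Y(2) sum_eq m_def \<rho>U \<sigma>W rel_form_coordinates[OF U W Y(1)] G_def[symmetric]
        using p0 q0 t by (intro sum_mono quadratic_form_max(1)) auto
    qed
    \<comment> \<open>The entrywise maximizer from \<open>quadratic_form_max\<close>.\<close>
    define Y where "Y = mat n n (\<lambda>(j, i). G $$ (j, i) * of_real (p i / (q j + t * p i)))"
    have Y: "Y \<in> carrier_mat n n" by (simp add: Y_def)
    show "\<exists>X\<in>carrier_mat n n. rel_form \<rho> \<sigma> t X = (\<Sum>z\<in>?I. c z / (x z + t))"
    proof (rule bexI)
      show "W * Y * adj U \<in> carrier_mat n n" using u w Y by auto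
      show "rel_form \<rho> \<sigma> t (W * Y * adj U) = (\<Sum>z\<in>?I. c z / (x z + t))"
        unfolding sum_eq m_def \<rho>U \<sigma>W rel_form_coordinates[OF U W Y] G_def[symmetric]
        using p0 q0 t by (intro sum.cong refl quadratic_form_max(2)) (auto simp: Y_def)
    qed
  qed
qed

text \<open>Each eigenvalue of \<sigma> is an average of diagonal entries of \<rho> over its
  eigenspace. This is the source of the positivity of conditional expectations.\<close>

lemma pinched_gram:
  assumes "pinched n \<rho> \<sigma>"
  shows "gram n \<sigma>"
proof -
  have \<rho>: "gram n \<rho>" and \<sigma>: "\<sigma> \<in> carrier_mat n n" "adj \<sigma> = \<sigma>"
    using assms by (auto simp: pinched_def)
  obtain U p where U: "unitary n U" and \<rho>U: "\<rho> = U * real_diag n p * adj U"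
    using hermitian_diagonalization gram_hermitian[OF \<rho>] by blast
  obtain W q where W: "unitary n W" and \<sigma>W: "\<sigma> = W * real_diag n q * adj W"
    using hermitian_diagonalization[OF \<sigma>] by blast
  show ?thesis
    unfolding \<sigma>W using pinched_eigenvalue_nonneg[OF assms U \<rho>U W \<sigma>W] by (intro gram_of_diag W)
qed

text \<open>For a pinching, \<open>vn_entropy \<sigma> - vn_entropy \<rho>\<close> is the relative entropy of \<open>\<rho>\<close> and \<open>\<sigma>\<close>.\<close>

lemma relative_entropy_mono:
  assumes "pinched n \<rho> \<sigma>" "pinched n' \<rho>' \<sigma>'" "mtrace \<rho> = mtrace \<rho>'"
    and ext: "\<And>t X'. t > 0 \<Longrightarrow> X' \<in> carrier_mat n' n' \<Longrightarrow>
      \<exists>X\<in>carrier_mat n n. rel_form \<rho>' \<sigma>' t X' \<le> rel_form \<rho> \<sigma> t X"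
  shows "vn_entropy \<sigma>' - vn_entropy \<rho>' \<le> vn_entropy \<sigma> - vn_entropy \<rho>"
proof -
  obtain c x where cx: "\<forall>z\<in>{..<n} \<times> {..<n}. 0 \<le> x z \<and> (x z = 0 \<longrightarrow> c z = 0)"
    "(\<Sum>z\<in>{..<n} \<times> {..<n}. c z) = Re (mtrace \<rho>)"
    "(\<Sum>z\<in>{..<n} \<times> {..<n}. c z * ln (x z)) = vn_entropy \<rho> - vn_entropy \<sigma>"
    "\<forall>t>0. \<forall>X\<in>carrier_mat n n. rel_form \<rho> \<sigma> t X \<le> (\<Sum>z\<in>{..<n} \<times> {..<n}. c z / (x z + t))"
    using pinched_spectral[OF assms(1)] by blast
  obtain c' x' where cx': "\<forall>z\<in>{..<n'} \<times> {..<n'}. 0 \<le> x' z \<and> (x' z = 0 \<longrightarrow> c' z = 0)"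
    "(\<Sum>z\<in>{..<n'} \<times> {..<n'}. c' z) = Re (mtrace \<rho>')"
    "(\<Sum>z\<in>{..<n'} \<times> {..<n'}. c' z * ln (x' z)) = vn_entropy \<rho>' - vn_entropy \<sigma>'"
    "\<forall>t>0. \<exists>X\<in>carrier_mat n' n'. rel_form \<rho>' \<sigma>' t X = (\<Sum>z\<in>{..<n'} \<times> {..<n'}. c' z / (x' z + t))"
    using pinched_spectral[OF assms(2)] by blast
  have "(\<Sum>z\<in>{..<n} \<times> {..<n}. c z * ln (x z)) \<le> (\<Sum>z\<in>{..<n'} \<times> {..<n'}. c' z * ln (x' z))"
  proof (rule ln_sum_le_of_resolvent_le)
    fix t :: real assume t: "t > 0"
    \<comment> \<open>The resolvent sum of the image pair is attained at some \<open>X'\<close>; the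
      competitor obtained from it for the original pair is bounded by the resolvent sum of that
      pair.\<close>
    obtain X' where X': "X' \<in> carrier_mat n' n'"
      "rel_form \<rho>' \<sigma>' t X' = (\<Sum>z\<in>{..<n'} \<times> {..<n'}. c' z / (x' z + t))" using cx'(4) t by blast
    obtain X where "X \<in> carrier_mat n n" "rel_form \<rho>' \<sigma>' t X' \<le> rel_form \<rho> \<sigma> t X"
      using ext[OF t X'(1)] by blast
    then show "(\<Sum>z\<in>{..<n'} \<times> {..<n'}. c' z / (x' z + t)) \<le> (\<Sum>z\<in>{..<n} \<times> {..<n}. c z / (x z + t))"
      using cx(4) t X'(2) by fastforce
  next
    show "(\<Sum>z\<in>{..<n} \<times> {..<n}. c z) = (\<Sum>z\<in>{..<n'} \<times> {..<n'}. c' z)"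
      unfolding cx(2) cx'(2) assms(3) ..
  qed ((rule finite_cartesian_product[OF finite_lessThan finite_lessThan] | use cx(1) cx'(1) in blast)+)
  then show ?thesis unfolding cx(3) cx'(3) by simp
qed

subsection \<open>Conditional expectations\<close>

text \<open>Induction on the coordinates. The vectors of \<open>N\<close> vanishing at the new
  coordinate form a subspace \<open>N0\<close> covered by the hypothesis. If \<open>N0\<close> is
  not all of \<open>N\<close>, then \<open>N\<close> is \<open>N0\<close> plus the line through
  \<open>u\<close>, the component orthogonal to \<open>N0\<close> of some \<open>w\<close> with
  \<open>w k\<close> nonzero; the projections onto both parts add up.\<close>

lemma orthogonal_projection_exists:
  fixes N :: "('i \<Rightarrow> complex) set"
  assumes "finite I" "(\<lambda>_. 0) \<in> N" "\<And>f g. f \<in> N \<Longrightarrow> g \<in> N \<Longrightarrow> (\<lambda>i. f i + g i) \<in> N"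
    "\<And>c f. f \<in> N \<Longrightarrow> (\<lambda>i. c * f i) \<in> N"
  shows "\<exists>x\<in>N. \<forall>b\<in>N. (\<Sum>i\<in>I. (a i - x i) * cnj (b i)) = 0"
  using assms
proof (induction I arbitrary: N a rule: finite_induct)
  case empty
  then show ?case by auto
next
  case (insert k I)
  note add = insert.prems(2) and scale = insert.prems(3)
  have sub: "(\<lambda>i. f i - c * g i) \<in> N" if "f \<in> N" "g \<in> N" for f g c
    using add[OF that(1) scale[OF that(2), of "- c"]] by simp
  show ?case
  proof (cases "\<forall>f\<in>N. f k = 0")
    case True
    obtain x where "x \<in> N" "\<forall>b\<in>N. (\<Sum>i\<in>I. (a i - x i) * cnj (b i)) = 0"
      using insert.IH[OF insert.prems] by blast
    then show ?thesis using True insert.hyps by (intro bexI[of _ x]) auto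
  next
    case False
    then obtain w where w: "w \<in> N" "w k \<noteq> 0" by blast
    define N0 where "N0 = {f\<in>N. f k = 0}"
    have ex: "\<exists>x\<in>N0. \<forall>b\<in>N0. (\<Sum>i\<in>I. (v i - x i) * cnj (b i)) = 0" for v
      using insert.prems by (intro insert.IH) (auto simp: N0_def)
    obtain y where y: "y \<in> N0" "\<And>b. b \<in> N0 \<Longrightarrow> (\<Sum>i\<in>I. (w i - y i) * cnj (b i)) = 0"
      using ex[of w] by blast
    obtain z where z: "z \<in> N0" "\<And>b. b \<in> N0 \<Longrightarrow> (\<Sum>i\<in>I. (a i - z i) * cnj (b i)) = 0"
      using ex[of a] by blast
    let ?K = "insert k I"
    define u where "u = (\<lambda>i. w i - y i)"
    have u: "u \<in> N" "u k \<noteq> 0" using sub[OF w(1), of y 1] y(1) w(2) by (auto simp: u_def N0_def fun_eq_iff)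
    have perp: "(\<Sum>i\<in>?K. u i * cnj (b i)) = 0" "(\<Sum>i\<in>?K. (a i - z i) * cnj (b i)) = 0" if "b \<in> N0" for b
      using y(2)[OF that] z(2)[OF that] that insert.hyps by (auto simp: u_def N0_def)
    define s where "s = (\<Sum>i\<in>?K. u i * cnj (u i))"
    have "s = of_real (\<Sum>i\<in>?K. (cmod (u i))\<^sup>2)"
      by (simp add: s_def complex_norm_square del: of_real_power)
    moreover have "(\<Sum>i\<in>?K. (cmod (u i))\<^sup>2) > 0"
      using u(2) insert.hyps by (intro sum_pos2[of _ k]) auto
    ultimately have s: "s \<noteq> 0" by (metis of_real_eq_0_iff less_irrefl)
    define t where "t = (\<Sum>i\<in>?K. a i * cnj (u i)) / s"
    define x where "x = (\<lambda>i. z i + t * u i)"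
    have "x \<in> N" using add[OF _ scale[OF u(1), of t], of z] z(1) by (auto simp: x_def N0_def fun_eq_iff)
    moreover have "(\<Sum>i\<in>?K. (a i - x i) * cnj (b i)) = 0" if b: "b \<in> N" for b
    proof -
      define c where "c = b k / u k"
      define b0 where "b0 = (\<lambda>i. b i - c * u i)"
      have b0: "b0 \<in> N0" using sub[OF b u(1), of c] u(2) by (auto simp: b0_def N0_def c_def fun_eq_iff)
      have "(\<Sum>i\<in>?K. (a i - x i) * cnj (b0 i)) = 
          (\<Sum>i\<in>?K. (a i - z i) * cnj (b0 i)) - t * (\<Sum>i\<in>?K. u i * cnj (b0 i))"
        by (simp only: x_def sum_distrib_left flip: sum_subtractf) (simp add: algebra_simps)
      then have 1: "(\<Sum>i\<in>?K. (a i - x i) * cnj (b0 i)) = 0" unfolding perp[OF b0] by simp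
      have "(\<Sum>i\<in>?K. z i * cnj (u i)) = cnj (\<Sum>i\<in>?K. u i * cnj (z i))" by (simp add: mult.commute)
      then have zu: "(\<Sum>i\<in>?K. z i * cnj (u i)) = 0" by (simp only: perp[OF z(1)] complex_cnj_zero)
      have "(\<Sum>i\<in>?K. (a i - x i) * cnj (u i)) = 
          (\<Sum>i\<in>?K. a i * cnj (u i)) - (\<Sum>i\<in>?K. z i * cnj (u i)) - t * s"
        by (simp only: x_def s_def sum_distrib_left flip: sum_subtractf) (simp add: algebra_simps)
      then have 2: "(\<Sum>i\<in>?K. (a i - x i) * cnj (u i)) = 0" unfolding zu using s by (simp add: t_def)
      have "(\<Sum>i\<in>?K. (a i - x i) * cnj (b i)) =
          (\<Sum>i\<in>?K. (a i - x i) * cnj (b0 i)) + cnj c * (\<Sum>i\<in>?K. (a i - x i) * cnj (u i))"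
        by (simp only: b0_def sum_distrib_left flip: sum.distrib) (simp add: algebra_simps)
      then show ?thesis unfolding 1 2 by simp
    qed
    ultimately show ?thesis by blast
  qed
qed

lemma subalgebraD:
  assumes "subalgebra n N"
  shows "a \<in> N \<Longrightarrow> a \<in> carrier_mat n n" "1\<^sub>m n \<in> N" "a \<in> N \<Longrightarrow> b \<in> N \<Longrightarrow> a + b \<in> N"
    "a \<in> N \<Longrightarrow> b \<in> N \<Longrightarrow> a * b \<in> N" "a \<in> N \<Longrightarrow> c \<cdot>\<^sub>m a \<in> N" "a \<in> N \<Longrightarrow> adj a \<in> N"
    "a \<in> N \<Longrightarrow> b \<in> N \<Longrightarrow> a - b \<in> N" "0\<^sub>m n n \<in> N" "a \<in> N \<Longrightarrow> a ^\<^sub>m k \<in> N"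
proof -
  note N = assms[unfolded subalgebra_def]
  show c: "a \<in> N \<Longrightarrow> a \<in> carrier_mat n n" for a using N by auto
  show one: "1\<^sub>m n \<in> N" and add: "a \<in> N \<Longrightarrow> b \<in> N \<Longrightarrow> a + b \<in> N"
    and mult: "a \<in> N \<Longrightarrow> b \<in> N \<Longrightarrow> a * b \<in> N" and smult: "a \<in> N \<Longrightarrow> c \<cdot>\<^sub>m a \<in> N"
    and "a \<in> N \<Longrightarrow> adj a \<in> N" for a b c using N by auto
  show "a - b \<in> N" if "a \<in> N" "b \<in> N"
  proof -
    have "a - b = a + (- 1) \<cdot>\<^sub>m b" using c[OF that(1)] c[OF that(2)] by (intro eq_matI) auto
    then show ?thesis using add[OF that(1) smult[OF that(2)]] by simp
  qed
  have "0\<^sub>m n n = 0 \<cdot>\<^sub>m (1\<^sub>m n :: complex mat)" by (intro eq_matI) auto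
  then show "0\<^sub>m n n \<in> N" using smult[OF one, of 0] by simp
  show "a ^\<^sub>m k \<in> N" if "a \<in> N"
    using c[OF that] that by (induction k) (auto simp: one mult)
qed

text \<open>The difference of two solutions lies in \<open>N\<close> and is trace-orthogonal to
  \<open>N\<close>, in particular to its own adjoint, so its Frobenius norm is 0. Concrete maps are
  identified as conditional expectations through this lemma.\<close>

lemma cond_exp_unique:
  assumes N: "subalgebra n N" and a: "a \<in> carrier_mat n n"
    and x: "x \<in> N" "\<forall>b\<in>N. mtrace (a * b) = mtrace (x * b)"
  shows "cond_exp N a = x"
  unfolding cond_exp_def
proof (rule the_equality)
  fix y assume y: "y \<in> N \<and> (\<forall>b\<in>N. mtrace (a * b) = mtrace (y * b))"
  have c: "x \<in> carrier_mat n n" "y \<in> carrier_mat n n" using subalgebraD(1)[OF N] x y by auto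
  let ?d = "y - x"
  have d: "?d \<in> N" "?d \<in> carrier_mat n n" using subalgebraD(7)[OF N] x y c by auto
  then have ad: "adj ?d \<in> N" using subalgebraD(6)[OF N] by blast
  have "mtrace (adj ?d * ?d) = mtrace (?d * adj ?d)"
    using d by (intro mtrace_comm[where n=n and m=n]) auto
  also have "\<dots> = mtrace (y * adj ?d) - mtrace (x * adj ?d)"
  proof -
    have "?d * adj ?d = y * adj ?d - x * adj ?d"
      using c d by (intro minus_mult_distrib_mat[of _ n n _ _ n]) auto
    then show ?thesis
      using c d by (simp add: mtrace_minus[OF mult_carrier_mat[of _ n n] mult_carrier_mat[of _ n n]])
  qed
  also have "\<dots> = 0" using x y ad by simp
  finally have "(\<Sum>i<n. \<Sum>j<n. (cmod (?d $$ (j, i)))\<^sup>2) = 0"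
    using mtrace_gram[OF d(2)] by (metis of_real_eq_0_iff)
  then have "\<forall>i<n. \<forall>j<n. ?d $$ (j, i) = 0"
    by (simp add: sum_nonneg_eq_0_iff sum_nonneg)
  then show "y = x" using c by (intro eq_matI) auto
qed (use x in auto)

text \<open>The conditional expectation is the orthogonal projection for the Hilbert-Schmidt inner
  product; closure of \<open>N\<close> under adjoints turns orthogonality into the bilinear trace
  identity.\<close>

lemma
  assumes N: "subalgebra n N" and a: "a \<in> carrier_mat n n"
  shows cond_exp_in: "cond_exp N a \<in> N"
    and mtrace_cond_exp: "b \<in> N \<Longrightarrow> mtrace (cond_exp N a * b) = mtrace (a * b)"
proof -
  note sub = subalgebraD[OF N]
  let ?I = "{..<n} \<times> {..<n}"
  \<comment> \<open>Values outside the index range are left free, so that \<open>F\<close> is a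
    space of functions on all pairs.\<close>
  define F where "F = {f. \<exists>A\<in>N. \<forall>i<n. \<forall>j<n. f (i, j) = A $$ (i, j)}"
  have "\<exists>x\<in>F. \<forall>b\<in>F. (\<Sum>z\<in>?I. (a $$ z - x z) * cnj (b z)) = 0"
  proof (rule orthogonal_projection_exists)
    show "(\<lambda>_. 0) \<in> F" unfolding F_def using sub(8) by (auto intro!: bexI[of _ "0\<^sub>m n n"])
    show "(\<lambda>i. f i + g i) \<in> F" if fg: "f \<in> F" "g \<in> F" for f g
    proof -
      obtain A B where AB: "A \<in> N" "B \<in> N" "\<forall>i<n. \<forall>j<n. f (i, j) = A $$ (i, j)" "\<forall>i<n. \<forall>j<n. g (i, j) = B $$ (i, j)"
        using fg by (auto simp: F_def)
      have c: "A \<in> carrier_mat n n" "B \<in> carrier_mat n n" using sub(1) AB(1,2) by blast+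
      show ?thesis unfolding F_def mem_Collect_eq
        by (rule bexI[OF _ sub(3)[OF AB(1,2)]]) (use c AB(3,4) in simp)
    qed
    show "(\<lambda>i. c * f i) \<in> F" if f: "f \<in> F" for f c
    proof -
      obtain A where A: "A \<in> N" "\<forall>i<n. \<forall>j<n. f (i, j) = A $$ (i, j)" using f by (auto simp: F_def)
      have "A \<in> carrier_mat n n" using sub(1) A(1) by blast
      then show ?thesis unfolding F_def mem_Collect_eq
        by (intro bexI[OF _ sub(5)[OF A(1), of c]]) (use A(2) in simp)
    qed
  qed auto
  then obtain f where f: "f \<in> F" "\<And>b. b \<in> F \<Longrightarrow> (\<Sum>z\<in>?I. (a $$ z - f z) * cnj (b z)) = 0" by blast
  then obtain x where x: "x \<in> N" "\<forall>i<n. \<forall>j<n. f (i, j) = x $$ (i, j)" by (auto simp: F_def)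
  have "mtrace (a * b) = mtrace (x * b)" if b: "b \<in> N" for b
  proof -
    have c: "x \<in> carrier_mat n n" "b \<in> carrier_mat n n" using sub(1) x b by auto
    have "(\<lambda>z. adj b $$ z) \<in> F" unfolding F_def using sub(6)[OF b] by auto
    note f(2)[OF this]
    also have "(\<Sum>z\<in>?I. (a $$ z - f z) * cnj (adj b $$ z))
        = (\<Sum>i<n. \<Sum>j<n. (a $$ (i, j) - x $$ (i, j)) * b $$ (j, i))"
      unfolding sum.cartesian_product using x(2) c by (intro sum.cong) auto
    finally have "(\<Sum>i<n. \<Sum>j<n. (a $$ (i, j) - x $$ (i, j)) * b $$ (j, i)) = 0" .
    then show ?thesis
      unfolding mtrace_mult_sum[OF a c(2)] mtrace_mult_sum[OF c]
      by (simp add: left_diff_distrib sum_subtractf)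
  qed
  then have "cond_exp N a = x" using cond_exp_unique[OF N a x(1)] by blast
  then show "cond_exp N a \<in> N" "b \<in> N \<Longrightarrow> mtrace (cond_exp N a * b) = mtrace (a * b)"
    using x(1) \<open>\<And>b. b \<in> N \<Longrightarrow> mtrace (a * b) = mtrace (x * b)\<close> by auto
qed

lemma mtrace_adj_mult:
  assumes "y \<in> carrier_mat n n" "b \<in> carrier_mat n n"
  shows "mtrace (adj y * b) = cnj (mtrace (y * adj b))"
proof -
  have "mtrace (y * adj b) = mtrace (adj b * y)"
    using assms by (intro mtrace_comm[where n=n and m=n]) auto
  moreover have "adj b * y = adj (adj y * b)" using assms by (simp add: adj_mult)
  moreover have "adj y * b \<in> carrier_mat n n" using assms by auto
  ultimately show ?thesis using mtrace_adj by simp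
qed

text \<open>The adjoint of the solution satisfies the same defining identities, so uniqueness
  applies.\<close>

lemma cond_exp_hermitian:
  assumes N: "subalgebra n N" and a: "a \<in> carrier_mat n n" "adj a = a"
  shows "adj (cond_exp N a) = cond_exp N a"
proof -
  note sub = subalgebraD[OF N]
  have x: "cond_exp N a \<in> N" by (rule cond_exp_in[OF N a(1)])
  have xc: "cond_exp N a \<in> carrier_mat n n" using sub(1) x by blast
  have "mtrace (a * b) = mtrace (adj (cond_exp N a) * b)" if b: "b \<in> N" for b
  proof -
    have bc: "b \<in> carrier_mat n n" using sub(1) b by blast
    note tr = mtrace_adj_mult[OF _ bc]
    show ?thesis using tr[OF a(1)] tr[OF xc] mtrace_cond_exp[OF N a(1) sub(6)[OF b]] a(2) by simp
  qed
  then show ?thesis using cond_exp_unique[OF N a(1) sub(6)[OF x]] by simp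
qed

text \<open>The powers of the conditional expectation lie in \<open>N\<close>, so they are
  admissible tests in its defining identity.\<close>

lemma pinched_cond_exp:
  assumes N: "subalgebra n N" and "gram n \<rho>"
  shows "pinched n \<rho> (cond_exp N \<rho>)"
proof -
  have \<rho>: "\<rho> \<in> carrier_mat n n" "adj \<rho> = \<rho>" using gram_hermitian[OF assms(2)] by auto
  note x = cond_exp_in[OF N \<rho>(1)]
  show ?thesis
    unfolding pinched_def
    using assms(2) subalgebraD(1)[OF N x] cond_exp_hermitian[OF N \<rho>]
      mtrace_cond_exp[OF N \<rho>(1) subalgebraD(9)[OF N x]] by simp
qed

lemma subalgebra_Int: "subalgebra n S \<Longrightarrow> subalgebra n T \<Longrightarrow> subalgebra n (S \<inter> T)"
  by (auto simp: subalgebra_def)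

lemma cond_exp_tower:
  assumes "subalgebra n N" "subalgebra n M" "N \<subseteq> M" and a: "a \<in> carrier_mat n n"
  shows "cond_exp N (cond_exp M a) = cond_exp N a"
  using assms cond_exp_in[OF assms(1) a] mtrace_cond_exp[OF assms(1) a] mtrace_cond_exp[OF assms(2) a]
    cond_exp_in[OF assms(2) a] subalgebraD(1)[OF assms(2)]
  by (intro cond_exp_unique[OF assms(1)]) auto

section \<open>Blocks, ampliations and partial traces on tensor products\<close>

lemma index_less: "i < m \<Longrightarrow> k < n \<Longrightarrow> i * n + k < m * (n::nat)"
  by (metis add_less_cancel_left add.commute less_le_trans mult.commute mult_Suc mult_le_mono2 Suc_leI)

lemma index_div_mod [simp]: "k < n \<Longrightarrow> (i * n + k) div n = i" "k < n \<Longrightarrow> (i * n + k) mod n = (k::nat)"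
  by auto

lemma sum_index_product:
  fixes f :: "nat \<Rightarrow> 'a::comm_monoid_add"
  shows "(\<Sum>r<m * n. f r) = (\<Sum>i<m. \<Sum>k<n. f (i * n + k))"
proof -
  have "(\<Sum>k<n. f (i * n + k)) = sum f {i * n..<i * n + n}" for i
    using sum.shift_bounds_nat_ivl[of f 0 "i * n" n] by (simp add: lessThan_atLeast0 add.commute)
  then show ?thesis using sum.nat_group[of f n m] by simp
qed

lemma less_product_cases:
  assumes "r < m * (n::nat)"
  obtains i k where "i < m" "k < n" "r = i * n + k"
  using that[of "r div n" "r mod n"] assms by (metis div_mult_mod_eq less_mult_imp_div_less mod_less_divisor mult_0_right not_less0 gr0I)

lemma eq_mat_productI:
  assumes "A \<in> carrier_mat (m * n) (m * n)" "B \<in> carrier_mat (m * n) (m * n)"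
    and "\<And>i k j l. i < m \<Longrightarrow> k < n \<Longrightarrow> j < m \<Longrightarrow> l < n \<Longrightarrow>
      A $$ (i * n + k, j * n + l) = B $$ (i * n + k, j * n + l)"
  shows "A = B"
proof (rule eq_matI)
  fix r s assume "r < dim_row B" "s < dim_col B"
  then have "r < m * n" "s < m * n" using assms by auto
  then obtain i k j l where "i < m" "k < n" "r = i * n + k" "j < m" "l < n" "s = j * n + l"
    by (metis less_product_cases)
  then show "A $$ (r, s) = B $$ (r, s)" using assms(3) by simp
qed (use assms in auto)

lemma blk_carrier [simp]: "blk dX dY R k l \<in> carrier_mat dX dX"
  and blk_dim [simp]: "dim_row (blk dX dY R k l) = dX" "dim_col (blk dX dY R k l) = dX"
  by (simp_all add: blk_def)

lemma blk_index [simp]: "i < dX \<Longrightarrow> j < dX \<Longrightarrow> blk dX dY R k l $$ (i, j) = R $$ (i * dY + k, j * dY + l)"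
  by (simp add: blk_def)

lemma mtrace_mult_blk:
  assumes "A \<in> carrier_mat (dX * dY) (dX * dY)" "B \<in> carrier_mat (dX * dY) (dX * dY)"
  shows "mtrace (A * B) = (\<Sum>k<dY. \<Sum>l<dY. mtrace (blk dX dY A k l * blk dX dY B l k))"
proof -
  have "mtrace (A * B) = (\<Sum>i<dX. \<Sum>k<dY. \<Sum>j<dX. \<Sum>l<dY. A $$ (i * dY + k, j * dY + l) * B $$ (j * dY + l, i * dY + k))"
    unfolding mtrace_mult_sum[OF assms] sum_index_product ..
  also have "\<dots> = (\<Sum>k<dY. \<Sum>i<dX. \<Sum>j<dX. \<Sum>l<dY. A $$ (i * dY + k, j * dY + l) * B $$ (j * dY + l, i * dY + k))"
    by (rule sum.swap)
  also have "\<dots> = (\<Sum>k<dY. \<Sum>l<dY. \<Sum>i<dX. \<Sum>j<dX. A $$ (i * dY + k, j * dY + l) * B $$ (j * dY + l, i * dY + k))"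
    by (subst (2) sum.swap, subst sum.swap) (rule refl)
  finally show ?thesis by (simp add: mtrace_mult_sum[of _ dX dX])
qed

text \<open>Block matrix multiplication, with the sum of blocks taken entrywise so that its size is
  fixed even when it is empty.\<close>

lemma blk_mult:
  assumes "A \<in> carrier_mat (dX * dY) (dX * dY)" "B \<in> carrier_mat (dX * dY) (dX * dY)" "k < dY" "l < dY"
  shows "blk dX dY (A * B) k l = mat dX dX (\<lambda>z. \<Sum>m<dY. (blk dX dY A k m * blk dX dY B m l) $$ z)"
proof (rule eq_matI)
  fix i j assume "i < dim_row (mat dX dX (\<lambda>z. \<Sum>m<dY. (blk dX dY A k m * blk dX dY B m l) $$ z))"
    "j < dim_col (mat dX dX (\<lambda>z. \<Sum>m<dY. (blk dX dY A k m * blk dX dY B m l) $$ z))"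
  then have ij: "i < dX" "j < dX" by auto
  have "blk dX dY (A * B) k l $$ (i, j) = (A * B) $$ (i * dY + k, j * dY + l)"
    using ij by simp
  also have "\<dots> = (\<Sum>r<dX * dY. A $$ (i * dY + k, r) * B $$ (r, j * dY + l))"
    using ij assms by (intro index_mult_sum) (auto intro: index_less)
  also have "\<dots> = (\<Sum>m<dY. \<Sum>h<dX. A $$ (i * dY + k, h * dY + m) * B $$ (h * dY + m, j * dY + l))"
    unfolding sum_index_product by (rule sum.swap)
  also have "\<dots> = (\<Sum>m<dY. (blk dX dY A k m * blk dX dY B m l) $$ (i, j))"
    using ij by (intro sum.cong refl) (simp add: index_mult_sum[of _ dX dX _ dX] del: index_mult_mat(1))
  finally show "blk dX dY (A * B) k l $$ (i, j) = mat dX dX (\<lambda>z. \<Sum>m<dY. (blk dX dY A k m * blk dX dY B m l) $$ z) $$ (i, j)"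
    using ij by simp
qed auto

lemma subalgebra_sum:
  assumes N: "subalgebra n N" and "\<And>d. d < m \<Longrightarrow> F d \<in> N"
  shows "mat n n (\<lambda>z. \<Sum>d<(m::nat). F d $$ z) \<in> N"
  using assms(2)
proof (induction m)
  case 0
  have "mat n n (\<lambda>z. \<Sum>d<0::nat. F d $$ z) = 0\<^sub>m n n" by (intro eq_matI) auto
  then show ?case using subalgebraD(8)[OF N] by simp
next
  case (Suc m)
  have c: "F m \<in> carrier_mat n n" using subalgebraD(1)[OF N] Suc.prems by blast
  have "mat n n (\<lambda>z. \<Sum>d<Suc m. F d $$ z) = mat n n (\<lambda>z. \<Sum>d<m. F d $$ z) + F m"
    using c by (intro eq_matI) auto
  then show ?case using subalgebraD(3)[OF N] Suc by simp
qed

text \<open>This is \<open>N\<close> tensor the full matrix algebra of the second factor.\<close>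

definition ampliation :: "nat \<Rightarrow> nat \<Rightarrow> complex mat set \<Rightarrow> complex mat set" where
  "ampliation dX dY N =
     {Z \<in> carrier_mat (dX * dY) (dX * dY). \<forall>k<dY. \<forall>l<dY. blk dX dY Z k l \<in> N}"

lemma subalgebra_ampliation:
  assumes N: "subalgebra dX N"
  shows "subalgebra (dX * dY) (ampliation dX dY N)"
  unfolding subalgebra_def
proof (intro conjI ballI allI)
  note sub = subalgebraD[OF N]
  show "ampliation dX dY N \<subseteq> carrier_mat (dX * dY) (dX * dY)" by (auto simp: ampliation_def)
  have "blk dX dY (1\<^sub>m (dX * dY)) k l = (if k = l then 1\<^sub>m dX else 0\<^sub>m dX dX)" if "k < dY" "l < dY" for k l
    using that by (intro eq_matI) (auto simp: index_less, (metis index_div_mod)+)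
  then show "1\<^sub>m (dX * dY) \<in> ampliation dX dY N" using sub by (auto simp: ampliation_def)
  fix a assume a: "a \<in> ampliation dX dY N"
  then have ac: "a \<in> carrier_mat (dX * dY) (dX * dY)" and an: "\<And>k l. k < dY \<Longrightarrow> l < dY \<Longrightarrow> blk dX dY a k l \<in> N"
    by (auto simp: ampliation_def)
  have "blk dX dY (adj a) k l = adj (blk dX dY a l k)" if "k < dY" "l < dY" for k l
    using that ac by (intro eq_matI) (auto simp: index_less)
  then show "adj a \<in> ampliation dX dY N" using sub(6) ac an by (auto simp: ampliation_def)
  have "blk dX dY (c \<cdot>\<^sub>m a) k l = c \<cdot>\<^sub>m blk dX dY a k l" if "k < dY" "l < dY" for k l c
    using that ac by (intro eq_matI) (auto simp: index_less)
  then show "c \<cdot>\<^sub>m a \<in> ampliation dX dY N" for c using sub(5) ac an by (auto simp: ampliation_def)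
  fix b assume b: "b \<in> ampliation dX dY N"
  then have bc: "b \<in> carrier_mat (dX * dY) (dX * dY)" and bn: "\<And>k l. k < dY \<Longrightarrow> l < dY \<Longrightarrow> blk dX dY b k l \<in> N"
    by (auto simp: ampliation_def)
  have "blk dX dY (a + b) k l = blk dX dY a k l + blk dX dY b k l" if "k < dY" "l < dY" for k l
    using that ac bc by (intro eq_matI) (auto simp: index_less)
  then show "a + b \<in> ampliation dX dY N" using sub(3) ac bc an bn by (auto simp: ampliation_def)
  have "blk dX dY (a * b) k l \<in> N" if kl: "k < dY" "l < dY" for k l
    unfolding blk_mult[OF ac bc kl] using kl by (intro subalgebra_sum[OF N] sub(4) an bn)
  then show "a * b \<in> ampliation dX dY N" using ac bc by (auto simp: ampliation_def)
qed

lemma on_first_carrier [simp]: "on_first dX dY dZ \<Phi> R \<in> carrier_mat (dZ * dY) (dZ * dY)"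
  by (simp add: on_first_def)

lemma on_first_index [simp]:
  "i < dZ \<Longrightarrow> j < dZ \<Longrightarrow> k < dY \<Longrightarrow> l < dY \<Longrightarrow>
    on_first dX dY dZ \<Phi> R $$ (i * dY + k, j * dY + l) = \<Phi> (blk dX dY R k l) $$ (i, j)"
  by (simp add: on_first_def index_less)

lemma blk_on_first:
  assumes "k < dY" "l < dY" "\<Phi> (blk dX dY R k l) \<in> carrier_mat dZ dZ"
  shows "blk dZ dY (on_first dX dY dZ \<Phi> R) k l = \<Phi> (blk dX dY R k l)"
  using assms by (intro eq_matI) auto

text \<open>The trace pairing is a sum of pairings of blocks, so the expectation taken blockwise
  satisfies the identities that define the expectation onto the ampliation.\<close>

lemma on_first_cond_exp:
  assumes N: "subalgebra dX N" and R: "R \<in> carrier_mat (dX * dY) (dX * dY)"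
  shows "on_first dX dY dX (cond_exp N) R = cond_exp (ampliation dX dY N) R"
proof (rule cond_exp_unique[OF subalgebra_ampliation[OF N] R, symmetric])
  let ?x = "on_first dX dY dX (cond_exp N) R"
  have bx: "blk dX dY ?x k l = cond_exp N (blk dX dY R k l)" if "k < dY" "l < dY" for k l
    using that cond_exp_in[OF N] subalgebraD(1)[OF N] by (intro blk_on_first) auto
  then show "?x \<in> ampliation dX dY N" using cond_exp_in[OF N] by (auto simp: ampliation_def)
  show "\<forall>b\<in>ampliation dX dY N. mtrace (R * b) = mtrace (?x * b)"
  proof
    fix b assume b: "b \<in> ampliation dX dY N"
    then have bc: "b \<in> carrier_mat (dX * dY) (dX * dY)" by (auto simp: ampliation_def)
    have "mtrace (blk dX dY R k l * blk dX dY b l k) = mtrace (blk dX dY ?x k l * blk dX dY b l k)"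
      if "k < dY" "l < dY" for k l
      unfolding bx[OF that] using b that by (intro mtrace_cond_exp[OF N, symmetric]) (auto simp: ampliation_def)
    then show "mtrace (R * b) = mtrace (?x * b)"
      using mtrace_mult_blk[OF R bc] mtrace_mult_blk[OF _ bc, of ?x] by simp
  qed
qed

definition tensor_one :: "nat \<Rightarrow> nat \<Rightarrow> complex mat \<Rightarrow> complex mat" where
  "tensor_one m d Z = mat (m * d) (m * d)
     (\<lambda>(r, s). if r mod d = s mod d then Z $$ (r div d, s div d) else 0)"

lemma tensor_one_carrier [simp]: "tensor_one m d Z \<in> carrier_mat (m * d) (m * d)"
  and tensor_one_dim [simp]: "dim_row (tensor_one m d Z) = m * d" "dim_col (tensor_one m d Z) = m * d"
  by (simp_all add: tensor_one_def)

lemma tensor_one_index [simp]: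
  "i < m \<Longrightarrow> k < d \<Longrightarrow> j < m \<Longrightarrow> l < d \<Longrightarrow>
    tensor_one m d Z $$ (i * d + k, j * d + l) = (if k = l then Z $$ (i, j) else 0)"
  by (simp add: tensor_one_def index_less)

lemma tensor_one_mult:
  assumes "A \<in> carrier_mat m m" "B \<in> carrier_mat m m"
  shows "tensor_one m d (A * B) = tensor_one m d A * tensor_one m d B"
proof (rule eq_mat_productI[of _ m d])
  fix i k j l assume h: "i < m" "k < d" "j < m" "l < d"
  have "(tensor_one m d A * tensor_one m d B) $$ (i * d + k, j * d + l) =
      (\<Sum>r<m * d. tensor_one m d A $$ (i * d + k, r) * tensor_one m d B $$ (r, j * d + l))"
    using h by (intro index_mult_sum[OF tensor_one_carrier tensor_one_carrier] index_less)
  also have "\<dots> = (\<Sum>h<m. \<Sum>q<d. if q = k then (if k = l then A $$ (i, h) * B $$ (h, j) else 0) else 0)"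
    unfolding sum_index_product using h by (intro sum.cong) auto
  also have "\<dots> = tensor_one m d (A * B) $$ (i * d + k, j * d + l)"
    using h assms by (simp add: index_mult_sum[of _ m m _ m] del: index_mult_mat(1))
  finally show "tensor_one m d (A * B) $$ (i * d + k, j * d + l)
    = (tensor_one m d A * tensor_one m d B) $$ (i * d + k, j * d + l)" ..
qed (auto intro: mult_carrier_mat[OF tensor_one_carrier tensor_one_carrier])

lemma adj_tensor_one:
  assumes "A \<in> carrier_mat m m"
  shows "adj (tensor_one m d A) = tensor_one m d (adj A)"
proof (rule eq_mat_productI[of _ m d])
  fix i k j l assume h: "i < m" "k < d" "j < m" "l < d"
  then have "i * d + k < dim_col (tensor_one m d A)" "j * d + l < dim_row (tensor_one m d A)"
    by (simp_all add: index_less)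
  then show "adj (tensor_one m d A) $$ (i * d + k, j * d + l) = tensor_one m d (adj A) $$ (i * d + k, j * d + l)"
    using h assms by simp
qed auto

text \<open>The duality of partial trace and tensoring with the identity, by which competitors move
  from the reduced to the full system.\<close>

lemma mtrace_ptrace2_mult:
  assumes "R \<in> carrier_mat (m * d) (m * d)" "Z \<in> carrier_mat m m"
  shows "mtrace (ptrace2 m d R * Z) = mtrace (R * tensor_one m d Z)"
proof -
  have "mtrace (R * tensor_one m d Z) = (\<Sum>i<m. \<Sum>k<d. \<Sum>j<m. \<Sum>l<d. if l = k then R $$ (i * d + k, j * d + k) * Z $$ (j, i) else 0)"
    unfolding mtrace_mult_sum[OF assms(1) tensor_one_carrier] sum_index_product by (intro sum.cong) auto
  also have "\<dots> = (\<Sum>i<m. \<Sum>j<m. \<Sum>k<d. R $$ (i * d + k, j * d + k) * Z $$ (j, i))"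
    by (subst (2) sum.swap) simp
  also have "\<dots> = mtrace (ptrace2 m d R * Z)"
    using assms(2) by (subst mtrace_mult_sum[of _ m m]) (auto simp: ptrace2_def sum_distrib_right)
  finally show ?thesis ..
qed

lemma tensor_one_ampliation:
  assumes N: "subalgebra dX N" and Z: "Z \<in> ampliation dX dY N"
  shows "tensor_one (dX * dY) d Z \<in> ampliation dX (dY * d) N"
proof -
  have "blk dX (dY * d) (tensor_one (dX * dY) d Z) k l \<in> N" if kl: "k < dY * d" "l < dY * d" for k l
  proof -
    obtain k1 k2 l1 l2 where k: "k1 < dY" "k2 < d" "k = k1 * d + k2" and l: "l1 < dY" "l2 < d" "l = l1 * d + l2"
      using kl by (metis less_product_cases)
    \<comment> \<open>Associativity of the tensor product at the level of indices.\<close>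
    have e: "i * (dY * d) + (k1 * d + k2) = (i * dY + k1) * d + k2" for i k1 k2 by (simp add: algebra_simps)
    have "blk dX (dY * d) (tensor_one (dX * dY) d Z) k l = (if k2 = l2 then blk dX dY Z k1 l1 else 0\<^sub>m dX dX)"
      unfolding k(3) l(3) using k l by (intro eq_matI) (auto simp: e index_less)
    then show ?thesis using Z k(1) l(1) subalgebraD(8)[OF N] by (auto simp: ampliation_def)
  qed
  then show ?thesis by (auto simp: ampliation_def mult.assoc[symmetric])
qed

text \<open>Moving the traced index from the rows of \<open>K\<close> to its columns yields a factor
  of the partial trace.\<close>

lemma gram_ptrace2:
  assumes "gram (m * d) A"
  shows "gram m (ptrace2 m d A)"
proof -
  obtain q K where K: "K \<in> carrier_mat (m * d) q" "A = K * adj K" using assms by (auto simp: gram_def)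
  define L where "L = mat m (d * q) (\<lambda>(x, s). K $$ (x * d + s div q, s mod q))"
  have L: "L \<in> carrier_mat m (d * q)" by (simp add: L_def)
  have "ptrace2 m d A = L * adj L"
  proof (rule eq_matI)
    fix i j assume "i < dim_row (L * adj L)" "j < dim_col (L * adj L)"
    then have ij: "i < m" "j < m" using L by auto
    have "(L * adj L) $$ (i, j) = (\<Sum>s<d * q. L $$ (i, s) * adj L $$ (s, j))"
      using L ij by (intro index_mult_sum) auto
    also have "\<dots> = (\<Sum>k<d. \<Sum>b<q. K $$ (i * d + k, b) * adj K $$ (b, j * d + k))"
      unfolding sum_index_product using ij L K by (intro sum.cong) (auto simp: L_def index_less)
    also have "\<dots> = (\<Sum>k<d. A $$ (i * d + k, j * d + k))"
      unfolding K(2) using K(1) ij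
      by (intro sum.cong refl index_mult_sum[symmetric]) (auto simp: index_less)
    finally show "ptrace2 m d A $$ (i, j) = (L * adj L) $$ (i, j)" using ij by (simp add: ptrace2_def)
  qed (use L in \<open>auto simp: ptrace2_def\<close>)
  then show ?thesis using L unfolding gram_def by blast
qed

subsection \<open>Purification and the complementary channel\<close>

text \<open>The cross terms vanish, as \<open>X - Z\<close> is orthogonal to \<open>N\<close>.\<close>

lemma mtrace_gram_projection_le:
  assumes N: "subalgebra n N" and A: "gram n A" "A \<in> N" and Z: "Z \<in> N" and X: "X \<in> carrier_mat n n"
    and orth: "\<And>b. b \<in> N \<Longrightarrow> mtrace (X * b) = mtrace (Z * b)"
  shows "Re (mtrace (A * (adj Z * Z))) \<le> Re (mtrace (A * (adj X * X)))"
proof -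
  note sub = subalgebraD[OF N]
  define R where "R = X - Z"
  have c: "A \<in> carrier_mat n n" "Z \<in> carrier_mat n n" "R \<in> carrier_mat n n"
    using sub(1) A Z X by (auto simp: R_def intro: minus_carrier_mat)
  note mc = mult_carrier_mat[of _ n n _ n]
  have R0: "mtrace (R * b) = 0" if b: "b \<in> N" for b
  proof -
    have "b \<in> carrier_mat n n" using sub(1) b by blast
    then have "R * b = X * b - Z * b"
      unfolding R_def using X c(2) by (intro minus_mult_distrib_mat[of _ n n]) auto
    then show ?thesis
      using orth[OF b] X c(2) \<open>b \<in> carrier_mat n n\<close> by (simp add: mtrace_minus[of _ n] mc)
  qed
  have XZR: "X = Z + R" unfolding R_def using X c by (intro eq_matI) auto
  have "A * (adj X * X) = A * (adj Z * Z) + A * (adj R * Z) + (A * (adj Z * R) + A * (adj R * R))"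
    unfolding XZR using c
    by (simp add: adj_add[of _ n n] add_mult_distrib_mat[of _ n n _ _ n] mult_add_distrib_mat[of _ n n _ n] mc)
  then have "mtrace (A * (adj X * X)) = mtrace (A * (adj Z * Z)) + mtrace (A * (adj R * Z))
      + (mtrace (A * (adj Z * R)) + mtrace (A * (adj R * R)))"
    using c by (simp add: mtrace_add[of _ n] mc)
  moreover have "mtrace (A * (adj Z * R)) = 0"
  proof -
    have "mtrace (A * (adj Z * R)) = mtrace ((A * adj Z) * R)" using c by (simp add: mult_assoc_dim)
    also have "\<dots> = mtrace (R * (A * adj Z))" using c by (intro mtrace_comm[of _ n n] mc) auto
    finally show ?thesis using R0[OF sub(4)[OF A(2) sub(6)[OF Z]]] by simp
  qed
  moreover have "mtrace (A * (adj R * Z)) = 0"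
  proof -
    have "mtrace (A * (adj R * Z)) = mtrace ((adj R * Z) * A)" using c by (intro mtrace_comm[of _ n n] mc) auto
    also have "\<dots> = mtrace (adj R * (Z * A))" using c by (simp add: mult_assoc_dim)
    also have "\<dots> = cnj (mtrace (R * adj (Z * A)))" using c by (intro mtrace_adj_mult) auto
    finally show ?thesis using R0[OF sub(6)[OF sub(4)[OF Z A(2)]]] by simp
  qed
  ultimately show ?thesis using gram_mtrace_nonneg[OF A(1) c(3)] by simp
qed

text \<open>The linear term is unchanged because \<rho> lies in \<open>N\<close>. The subtracted
  quadratic terms can only shrink under projection; for the term in \<sigma> this is applied to
  \<open>adj X\<close>, whose projection is the adjoint of that of \<open>X\<close>.\<close>

lemma rel_form_cond_exp_le:
  assumes N: "subalgebra n N" and \<rho>: "gram n \<rho>" "\<rho> \<in> N" and \<sigma>: "gram n \<sigma>" "\<sigma> \<in> N"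
    and X: "X \<in> carrier_mat n n" and t: "0 < t"
  shows "rel_form \<rho> \<sigma> t X \<le> rel_form \<rho> \<sigma> t (cond_exp N X)"
proof -
  note sub = subalgebraD[OF N]
  let ?Z = "cond_exp N X"
  have Z: "?Z \<in> N" by (rule cond_exp_in[OF N X])
  then have Zc: "?Z \<in> carrier_mat n n" and \<rho>c: "\<rho> \<in> carrier_mat n n" using sub(1) \<rho> by auto
  note orth = mtrace_cond_exp[OF N X, symmetric]
  have orth': "mtrace (adj X * b) = mtrace (adj ?Z * b)" if b: "b \<in> N" for b
    using mtrace_adj_mult[OF X sub(1)[OF b]] mtrace_adj_mult[OF Zc sub(1)[OF b]] orth[OF sub(6)[OF b]] by simp
  have "Re (mtrace (\<rho> * (adj ?Z * ?Z))) \<le> Re (mtrace (\<rho> * (adj X * X)))"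
    by (rule mtrace_gram_projection_le[OF N \<rho> Z X orth])
  moreover have "Re (mtrace (\<sigma> * (?Z * adj ?Z))) \<le> Re (mtrace (\<sigma> * (X * adj X)))"
    using mtrace_gram_projection_le[OF N \<sigma> sub(6)[OF Z] adj_carrier[OF X] orth'] by simp
  moreover have "mtrace (\<rho> * adj X) = mtrace (\<rho> * adj ?Z)"
    using mtrace_comm[OF \<rho>c adj_carrier[OF X]] mtrace_comm[OF \<rho>c adj_carrier[OF Zc]] orth'[OF \<rho>(2)] by simp
  ultimately show ?thesis unfolding rel_form_def using t by (simp add: add_mono mult_left_mono diff_mono)
qed

section \<open>Reshapings of a purification\<close>

lemma sum_rotate: "(\<Sum>a\<in>A. \<Sum>b\<in>B. \<Sum>c\<in>C. f a b c) = (\<Sum>c\<in>C. \<Sum>a\<in>A. \<Sum>b\<in>B. f a b c)"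
proof -
  have "(\<Sum>a\<in>A. \<Sum>b\<in>B. \<Sum>c\<in>C. f a b c) = (\<Sum>a\<in>A. \<Sum>c\<in>C. \<Sum>b\<in>B. f a b c)"
    by (intro sum.cong refl sum.swap)
  also have "\<dots> = (\<Sum>c\<in>C. \<Sum>a\<in>A. \<Sum>b\<in>B. f a b c)" by (rule sum.swap)
  finally show ?thesis .
qed

lemma sandwich_index:
  assumes "V \<in> carrier_mat m n" "X \<in> carrier_mat n n" "i < m" "j < m"
  shows "(V * X * adj V) $$ (i, j) = (\<Sum>a<n. \<Sum>b<n. V $$ (i, a) * X $$ (a, b) * cnj (V $$ (j, b)))"
proof -
  have "(V * X * adj V) $$ (i, j) = (\<Sum>b<n. (V * X) $$ (i, b) * adj V $$ (b, j))"
    using assms by (intro index_mult_sum[of _ m n _ m]) auto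
  also have "\<dots> = (\<Sum>b<n. \<Sum>a<n. V $$ (i, a) * X $$ (a, b) * cnj (V $$ (j, b)))"
    using assms by (intro sum.cong refl)
      (simp add: index_mult_sum[of _ m n _ n] sum_distrib_right del: index_mult_mat(1))
  finally show ?thesis by (subst sum.swap)
qed

text \<open>\<open>\<psi> a b y\<close> is the amplitude of a purification of the state, with \<open>y\<close> ranging over the joint
  system of \<open>C\<close> and the purifying space; \<open>K\<close> and \<open>L\<close> are its reshapings before and after \<open>V\<close>.\<close>

context
  fixes dA dB dC m :: nat and M :: "complex mat"
  assumes M: "M \<in> carrier_mat (dA * dB * dC) m"
begin

definition amplitude :: "nat \<Rightarrow> nat \<Rightarrow> nat \<Rightarrow> complex" where
  "amplitude a b y = M $$ ((a * dB + b) * dC + y div m, y mod m)"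

definition reshape :: "complex mat" where
  "reshape = mat (dA * (dC * m)) dB (\<lambda>(r, b). amplitude (r div (dC * m)) b (r mod (dC * m)))"

definition reshape_dilated :: "nat \<Rightarrow> complex mat \<Rightarrow> complex mat" where
  "reshape_dilated dF V = mat (dA * (dC * m)) (dF * dB) (\<lambda>(r, s). \<Sum>a<dA.
     V $$ ((r div (dC * m)) * dF + s div dB, a) * amplitude a (s mod dB) (r mod (dC * m)))"

lemma amplitude_product: "c < dC \<Longrightarrow> d < m \<Longrightarrow> amplitude a b (c * m + d) = M $$ ((a * dB + b) * dC + c, d)"
  by (simp add: amplitude_def)

lemma state_index:
  assumes "a < dA" "b < dB" "c < dC" "a' < dA" "b' < dB" "c' < dC"
  shows "(M * adj M) $$ ((a * dB + b) * dC + c, (a' * dB + b') * dC + c') =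
    (\<Sum>d<m. amplitude a b (c * m + d) * cnj (amplitude a' b' (c' * m + d)))"
  using M assms by (subst index_mult_sum[of _ "dA * dB * dC" m _ "dA * dB * dC"])
    (auto simp: index_less amplitude_product intro!: sum.cong)

lemma reshape_carrier: "reshape \<in> carrier_mat (dA * (dC * m)) dB"
  by (simp add: reshape_def)

lemma reshape_dilated_carrier: "reshape_dilated dF V \<in> carrier_mat (dA * (dC * m)) (dF * dB)"
  by (simp add: reshape_dilated_def)

lemma reshape_index: "a < dA \<Longrightarrow> y < dC * m \<Longrightarrow> b < dB \<Longrightarrow> reshape $$ (a * (dC * m) + y, b) = amplitude a b y"
  by (simp add: reshape_def index_less)

lemma reshape_dilated_index:
  "a < dA \<Longrightarrow> y < dC * m \<Longrightarrow> f < dF \<Longrightarrow> b < dB \<Longrightarrow>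
    reshape_dilated dF V $$ (a * (dC * m) + y, f * dB + b) = (\<Sum>e<dA. V $$ (a * dF + f, e) * amplitude e b y)"
  by (simp add: reshape_dilated_def index_less)

lemma reshape_gram_index:
  assumes "a < dA" "y < dC * m" "a' < dA" "y' < dC * m"
  shows "(reshape * adj reshape) $$ (a * (dC * m) + y, a' * (dC * m) + y') =
    (\<Sum>b<dB. amplitude a b y * cnj (amplitude a' b y'))"
  using assms reshape_carrier
  by (subst index_mult_sum[of _ "dA * (dC * m)" dB _ "dA * (dC * m)"])
    (auto simp: index_less reshape_index intro!: sum.cong)

lemma red_AB_index:
  assumes "a < dA" "b < dB" "a' < dA" "b' < dB"
  shows "red_AB dA dB dC (M * adj M) $$ (a * dB + b, a' * dB + b') =
    (\<Sum>y<dC * m. amplitude a b y * cnj (amplitude a' b' y))"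
  using assms unfolding sum_index_product red_AB_def ptrace2_def
  by (auto simp: index_less state_index intro!: sum.cong)

lemma ptrace2_reshape: "ptrace2 (dA * dC) m (reshape * adj reshape) = red_AC dA dB dC (M * adj M)"
proof (rule eq_mat_productI[of _ dA dC])
  fix a c a' c' assume h: "a < dA" "c < dC" "a' < dA" "c' < dC"
  have e: "(a * dC + c) * m + d = a * (dC * m) + (c * m + d)" for a c d by (simp add: algebra_simps)
  have "ptrace2 (dA * dC) m (reshape * adj reshape) $$ (a * dC + c, a' * dC + c') =
      (\<Sum>d<m. \<Sum>b<dB. amplitude a b (c * m + d) * cnj (amplitude a' b (c' * m + d)))"
    using h by (auto simp: ptrace2_def index_less e reshape_gram_index simp del: index_mult_mat(1) intro!: sum.cong)
  also have "\<dots> = (\<Sum>b<dB. \<Sum>d<m. amplitude a b (c * m + d) * cnj (amplitude a' b (c' * m + d)))"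
    by (rule sum.swap)
  also have "\<dots> = red_AC dA dB dC (M * adj M) $$ (a * dC + c, a' * dC + c')"
    using h by (auto simp: red_AC_def index_less state_index simp del: index_mult_mat(1) intro!: sum.cong)
  finally show "ptrace2 (dA * dC) m (reshape * adj reshape) $$ (a * dC + c, a' * dC + c')
    = red_AC dA dB dC (M * adj M) $$ (a * dC + c, a' * dC + c')" .
qed (auto simp: ptrace2_def red_AC_def)

text \<open>Summing over the rows leaves the state on B, but the product
  \<open>adj reshape * reshape\<close> conjugates its row index instead of its column index; hence
  the transpose.\<close>

lemma red_B_reshape: "red_B dA dB dC (M * adj M) = transpose_mat (adj reshape * reshape)"
proof (rule eq_matI)
  fix b b' assume "b < dim_row (transpose_mat (adj reshape * reshape))" "b' < dim_col (transpose_mat (adj reshape * reshape))"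
  then have h: "b < dB" "b' < dB" using reshape_carrier by auto
  have "red_B dA dB dC (M * adj M) $$ (b, b') = (\<Sum>a<dA. \<Sum>y<dC * m. amplitude a b y * cnj (amplitude a b' y))"
    using h by (simp add: red_B_def ptrace1_def red_AB_index)
  also have "\<dots> = (\<Sum>r<dA * (dC * m). cnj (reshape $$ (r, b')) * reshape $$ (r, b))"
    unfolding sum_index_product[of _ dA] using h by (intro sum.cong) (auto simp: reshape_index)
  also have "\<dots> = (adj reshape * reshape) $$ (b', b)"
    using h by (intro index_adj_mult[OF reshape_carrier reshape_carrier, symmetric])
  finally show "red_B dA dB dC (M * adj M) $$ (b, b') = transpose_mat (adj reshape * reshape) $$ (b, b')"
    using h reshape_carrier by (simp del: index_mult_mat(1))
qed (use reshape_carrier in \<open>auto simp: red_B_def ptrace1_def\<close>)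

text \<open>The sum over \<open>f\<close> from the dilation and the sum over \<open>b\<close> from
  tracing out B together form the column index of \<open>reshape_dilated\<close>.\<close>

lemma on_first_cond_exp_reshape:
  assumes V: "stinespring dA dF S V"
  shows "on_first dA (dC * m) dA (cond_exp S) (reshape * adj reshape) =
    reshape_dilated dF V * adj (reshape_dilated dF V)"
proof (rule eq_mat_productI[of _ dA "dC * m"])
  have Vc: "V \<in> carrier_mat (dA * dF) dA" using V by (simp add: stinespring_def)
  note L = reshape_dilated_carrier[of dF V]
  fix a y a' y' assume h: "a < dA" "y < dC * m" "a' < dA" "y' < dC * m"
  let ?X = "blk dA (dC * m) (reshape * adj reshape) y y'"
  have "on_first dA (dC * m) dA (cond_exp S) (reshape * adj reshape) $$ (a * (dC * m) + y, a' * (dC * m) + y')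
      = ptrace2 dA dF (V * ?X * adj V) $$ (a, a')"
    using h V by (simp add: stinespring_def)
  also have "\<dots> = (\<Sum>f<dF. \<Sum>e<dA. \<Sum>e'<dA. V $$ (a * dF + f, e) * ?X $$ (e, e') * cnj (V $$ (a' * dF + f, e')))"
    using h Vc by (auto simp: ptrace2_def index_less sandwich_index[of _ "dA * dF" dA] simp del: index_mult_mat(1) intro!: sum.cong)
  also have "\<dots> = (\<Sum>f<dF. \<Sum>e<dA. \<Sum>e'<dA. \<Sum>b<dB. (V $$ (a * dF + f, e) * amplitude e b y)
      * cnj (V $$ (a' * dF + f, e') * amplitude e' b y'))"
    using h by (intro sum.cong refl)
      (simp add: reshape_gram_index sum_distrib_left sum_distrib_right mult_ac del: index_mult_mat(1))
  also have "\<dots> = (\<Sum>f<dF. \<Sum>b<dB. \<Sum>e<dA. \<Sum>e'<dA. (V $$ (a * dF + f, e) * amplitude e b y)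
      * cnj (V $$ (a' * dF + f, e') * amplitude e' b y'))"
    by (rule sum.cong[OF refl sum_rotate])
  also have "\<dots> = (\<Sum>s<dF * dB. reshape_dilated dF V $$ (a * (dC * m) + y, s)
      * adj (reshape_dilated dF V) $$ (s, a' * (dC * m) + y'))"
    unfolding sum_index_product using h L
    by (intro sum.cong refl) (auto simp: index_less reshape_dilated_index sum_product)
  also have "\<dots> = (reshape_dilated dF V * adj (reshape_dilated dF V)) $$ (a * (dC * m) + y, a' * (dC * m) + y')"
    using h L by (intro index_mult_sum[symmetric]) (auto simp: index_less)
  finally show "on_first dA (dC * m) dA (cond_exp S) (reshape * adj reshape) $$ (a * (dC * m) + y, a' * (dC * m) + y')
    = (reshape_dilated dF V * adj (reshape_dilated dF V)) $$ (a * (dC * m) + y, a' * (dC * m) + y')" .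
qed (auto intro!: mult_carrier_mat[OF reshape_dilated_carrier adj_carrier[OF reshape_dilated_carrier]])

text \<open>Dually, the sums over \<open>a\<close> and \<open>y\<close> form its row index. Both
  channel outputs thus come from the two Gram matrices of one matrix.\<close>

lemma on_first_compl_ch_reshape:
  assumes V: "V \<in> carrier_mat (dA * dF) dA"
  shows "on_first dA dB dF (compl_ch dA dF V) (red_AB dA dB dC (M * adj M)) =
    transpose_mat (adj (reshape_dilated dF V) * reshape_dilated dF V)"
proof (rule eq_mat_productI[of _ dF dB])
  let ?L = "reshape_dilated dF V"
  note L = reshape_dilated_carrier[of dF V]
  show "transpose_mat (adj ?L * ?L) \<in> carrier_mat (dF * dB) (dF * dB)" using L by auto
  fix f b f' b' assume h: "f < dF" "b < dB" "f' < dF" "b' < dB"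
  let ?X = "blk dA dB (red_AB dA dB dC (M * adj M)) b b'"
  have "on_first dA dB dF (compl_ch dA dF V) (red_AB dA dB dC (M * adj M)) $$ (f * dB + b, f' * dB + b')
      = ptrace1 dA dF (V * ?X * adj V) $$ (f, f')"
    using h by (simp add: compl_ch_def)
  also have "\<dots> = (\<Sum>a<dA. \<Sum>e<dA. \<Sum>e'<dA. V $$ (a * dF + f, e) * ?X $$ (e, e') * cnj (V $$ (a * dF + f', e')))"
    using h V by (auto simp: ptrace1_def index_less sandwich_index[of _ "dA * dF" dA] simp del: index_mult_mat(1) intro!: sum.cong)
  also have "\<dots> = (\<Sum>a<dA. \<Sum>e<dA. \<Sum>e'<dA. \<Sum>y<dC * m. (V $$ (a * dF + f, e) * amplitude e b y)
      * cnj (V $$ (a * dF + f', e') * amplitude e' b' y))"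
    using h by (intro sum.cong refl)
      (simp add: red_AB_index sum_distrib_left sum_distrib_right mult_ac)
  also have "\<dots> = (\<Sum>a<dA. \<Sum>y<dC * m. \<Sum>e<dA. \<Sum>e'<dA. (V $$ (a * dF + f, e) * amplitude e b y)
      * cnj (V $$ (a * dF + f', e') * amplitude e' b' y))"
    by (rule sum.cong[OF refl sum_rotate])
  also have "\<dots> = (\<Sum>r<dA * (dC * m). ?L $$ (r, f * dB + b) * cnj (?L $$ (r, f' * dB + b')))"
    unfolding sum_index_product[of _ dA] using h
    by (intro sum.cong refl) (auto simp: reshape_dilated_index sum_product)
  also have "\<dots> = (adj ?L * ?L) $$ (f' * dB + b', f * dB + b)"
    unfolding index_adj_mult[OF L L index_less[OF h(3,4)] index_less[OF h(1,2)]]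
    by (simp only: mult.commute)
  finally show "on_first dA dB dF (compl_ch dA dF V) (red_AB dA dB dC (M * adj M)) $$ (f * dB + b, f' * dB + b')
    = transpose_mat (adj ?L * ?L) $$ (f * dB + b, f' * dB + b')"
    using h L by (simp add: index_less del: index_mult_mat(1))
qed auto

end

subsection \<open>Commuting squares\<close>

lemma cond_exp_ampliation_compose:
  assumes S: "subalgebra dX S" and T: "subalgebra dX T" and N: "subalgebra dX N"
    and comp: "\<forall>X\<in>carrier_mat dX dX. cond_exp T (cond_exp S X) = cond_exp N X"
    and R: "R \<in> carrier_mat (dX * dY) (dX * dY)"
  shows "cond_exp (ampliation dX dY T) (cond_exp (ampliation dX dY S) R) = cond_exp (ampliation dX dY N) R"
proof -
  let ?E = "\<lambda>N. on_first dX dY dX (cond_exp N)"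
  have "?E T (?E S R) = ?E N R"
  proof (rule eq_mat_productI[of _ dX dY])
    fix i k j l assume h: "i < dX" "k < dY" "j < dX" "l < dY"
    have "blk dX dY (?E S R) k l = cond_exp S (blk dX dY R k l)"
      using h cond_exp_in[OF S] subalgebraD(1)[OF S] by (intro blk_on_first) auto
    then show "?E T (?E S R) $$ (i * dY + k, j * dY + l) = ?E N R $$ (i * dY + k, j * dY + l)"
      using h comp by simp
  qed auto
  moreover have "?E T (?E S R) = cond_exp (ampliation dX dY T) (?E S R)"
    by (rule on_first_cond_exp[OF T on_first_carrier])
  ultimately show ?thesis
    by (simp add: on_first_cond_exp[OF S R] on_first_cond_exp[OF N R])
qed

text \<open>Under the trace pairing the partial trace becomes \<open>tensor_one\<close>, which maps
  the small ampliation into the large one, so tests pass between the two. Blocks of the partial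
  trace are sums of blocks, hence stay in \<open>N\<close>.\<close>

lemma cond_exp_ptrace2:
  assumes N: "subalgebra dX N" and R: "R \<in> carrier_mat (dX * dY * d) (dX * dY * d)"
  shows "ptrace2 (dX * dY) d (cond_exp (ampliation dX (dY * d) N) R)
    = cond_exp (ampliation dX dY N) (ptrace2 (dX * dY) d R)"
proof (rule cond_exp_unique[OF subalgebra_ampliation[OF N], symmetric])
  let ?N = "ampliation dX (dY * d) N"
  let ?x = "cond_exp ?N R"
  note N' = subalgebra_ampliation[OF N, of "dY * d"]
  have R': "R \<in> carrier_mat (dX * (dY * d)) (dX * (dY * d))" using R by (simp add: mult.assoc)
  have x: "?x \<in> ?N" by (rule cond_exp_in[OF N' R'])
  then have xc: "?x \<in> carrier_mat (dX * dY * d) (dX * dY * d)" by (simp add: ampliation_def mult.assoc)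
  show "ptrace2 (dX * dY) d R \<in> carrier_mat (dX * dY) (dX * dY)" by (simp add: ptrace2_def)
  have "blk dX dY (ptrace2 (dX * dY) d ?x) k l \<in> N" if kl: "k < dY" "l < dY" for k l
  proof -
    have e: "(i * dY + k) * d + q = i * (dY * d) + (k * d + q)" for i k q by (simp add: algebra_simps)
    have "blk dX dY (ptrace2 (dX * dY) d ?x) k l
        = mat dX dX (\<lambda>z. \<Sum>q<d. blk dX (dY * d) ?x (k * d + q) (l * d + q) $$ z)"
      using kl by (intro eq_matI) (auto simp: ptrace2_def index_less e)
    also have "\<dots> \<in> N"
      using x kl by (intro subalgebra_sum[OF N]) (auto simp: ampliation_def index_less)
    finally show ?thesis .
  qed
  then show "ptrace2 (dX * dY) d ?x \<in> ampliation dX dY N" by (auto simp: ampliation_def ptrace2_def)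
  show "\<forall>b\<in>ampliation dX dY N. mtrace (ptrace2 (dX * dY) d R * b) = mtrace (ptrace2 (dX * dY) d ?x * b)"
  proof
    fix b assume b: "b \<in> ampliation dX dY N"
    then have bc: "b \<in> carrier_mat (dX * dY) (dX * dY)" by (simp add: ampliation_def)
    show "mtrace (ptrace2 (dX * dY) d R * b) = mtrace (ptrace2 (dX * dY) d ?x * b)"
      using mtrace_cond_exp[OF N' R' tensor_one_ampliation[OF N b]]
      by (simp add: mtrace_ptrace2_mult[OF R bc] mtrace_ptrace2_mult[OF xc bc])
  qed
qed

lemma mtrace_ptrace2:
  assumes "R \<in> carrier_mat (m * d) (m * d)"
  shows "mtrace (ptrace2 m d R) = mtrace R"
  using assms by (simp add: mtrace_def ptrace2_def sum_index_product)

lemma mtrace_cond_exp_eq: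
  assumes "subalgebra n N" "a \<in> carrier_mat n n"
  shows "mtrace (cond_exp N a) = mtrace a"
  using mtrace_cond_exp[OF assms subalgebraD(2)[OF assms(1)]]
    subalgebraD(1)[OF assms(1) cond_exp_in[OF assms]] assms(2) by (simp add: right_mult_one_mat)

text \<open>Data processing for the relative entropy of \<open>\<rho>\<close> and \<open>E\<^sub>S \<rho>\<close> under the partial trace over
  the last factor followed by \<open>E\<^sub>T\<close>.\<close>

lemma commuting_square_entropy_gap:
  assumes S: "subalgebra dX S" and T: "subalgebra dX T"
    and square: "\<forall>X\<in>carrier_mat dX dX. cond_exp T (cond_exp S X) = cond_exp (S \<inter> T) X"
    and \<rho>: "gram (dX * dY * d) \<rho>"
  defines "R \<equiv> ptrace2 (dX * dY) d \<rho>"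
  shows "vn_entropy (cond_exp (ampliation dX dY (S \<inter> T)) R) - vn_entropy (cond_exp (ampliation dX dY T) R)
    \<le> vn_entropy (cond_exp (ampliation dX (dY * d) S) \<rho>) - vn_entropy \<rho>"
proof (rule relative_entropy_mono)
  let ?n = "dX * dY * d" and ?m = "dX * dY"
  let ?S1 = "ampliation dX (dY * d) S" and ?S = "ampliation dX dY S"
  let ?T = "ampliation dX dY T" and ?I = "ampliation dX dY (S \<inter> T)"
  note I = subalgebra_Int[OF S T]
  have sS1: "subalgebra ?n ?S1" using subalgebra_ampliation[OF S, of "dY * d"] by (simp add: mult.assoc)
  note sS = subalgebra_ampliation[OF S, of dY] and sT = subalgebra_ampliation[OF T, of dY]
    and sI = subalgebra_ampliation[OF I, of dY]
  have IT: "?I \<subseteq> ?T" by (auto simp: ampliation_def)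
  have \<rho>c: "\<rho> \<in> carrier_mat ?n ?n" using gram_hermitian[OF \<rho>] by blast
  have gR: "gram ?m R" unfolding R_def by (rule gram_ptrace2[OF \<rho>])
  then have Rc: "R \<in> carrier_mat ?m ?m" using gram_hermitian by blast
  define \<sigma> where "\<sigma> = cond_exp ?S1 \<rho>"
  define \<rho>' where "\<rho>' = cond_exp ?T R"
  define \<sigma>' where "\<sigma>' = cond_exp ?I R"
  have \<sigma>c: "\<sigma> \<in> carrier_mat ?n ?n" unfolding \<sigma>_def using cond_exp_in[OF sS1 \<rho>c] subalgebraD(1)[OF sS1] by blast
  have \<rho>'T: "\<rho>' \<in> ?T" unfolding \<rho>'_def by (rule cond_exp_in[OF sT Rc])
  have \<sigma>'I: "\<sigma>' \<in> ?I" unfolding \<sigma>'_def by (rule cond_exp_in[OF sI Rc])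
  have g\<rho>': "gram ?m \<rho>'" unfolding \<rho>'_def by (rule pinched_gram[OF pinched_cond_exp[OF sT gR]])
  \<comment> \<open>Makes the image pair a state and its conditional expectation, so that its
    relative entropy is again a difference of entropies.\<close>
  have \<sigma>'\<rho>': "\<sigma>' = cond_exp ?I \<rho>'" unfolding \<sigma>'_def \<rho>'_def by (rule cond_exp_tower[OF sI sT IT Rc, symmetric])
  show "pinched ?n \<rho> (cond_exp ?S1 \<rho>)" by (rule pinched_cond_exp[OF sS1 \<rho>])
  have pin': "pinched ?m \<rho>' \<sigma>'" unfolding \<sigma>'\<rho>' by (rule pinched_cond_exp[OF sI g\<rho>'])
  then show "pinched ?m (cond_exp ?T R) (cond_exp ?I R)" unfolding \<rho>'_def \<sigma>'_def .
  show "mtrace \<rho> = mtrace (cond_exp ?T R)"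
    unfolding mtrace_cond_exp_eq[OF sT Rc] unfolding R_def by (rule mtrace_ptrace2[OF \<rho>c, symmetric])
  have tr\<rho>: "mtrace (\<rho>' * b) = mtrace (\<rho> * tensor_one ?m d b)" if b: "b \<in> ?T" for b
    unfolding \<rho>'_def mtrace_cond_exp[OF sT Rc b] unfolding R_def
    by (rule mtrace_ptrace2_mult[OF \<rho>c subalgebraD(1)[OF sT b]])
  \<comment> \<open>The commuting square enters here: \<sigma>' is the expectation onto
    \<open>?T\<close> of the reduced \<sigma>, so elements of \<open>?T\<close> do not distinguish
    the two.\<close>
  have tr\<sigma>: "mtrace (\<sigma>' * b) = mtrace (\<sigma> * tensor_one ?m d b)" if b: "b \<in> ?T" for b
  proof -
    have "\<sigma>' = cond_exp ?T (cond_exp ?S R)"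
      unfolding \<sigma>'_def by (rule cond_exp_ampliation_compose[OF S T I square Rc, symmetric])
    then have "mtrace (\<sigma>' * b) = mtrace (cond_exp ?S R * b)"
      using mtrace_cond_exp[OF sT subalgebraD(1)[OF sS cond_exp_in[OF sS Rc]] b] by simp
    also have "cond_exp ?S R = ptrace2 ?m d \<sigma>"
      unfolding R_def \<sigma>_def by (rule cond_exp_ptrace2[OF S \<rho>c, symmetric])
    finally show ?thesis using mtrace_ptrace2_mult[OF \<sigma>c subalgebraD(1)[OF sT b]] by simp
  qed
  fix t :: real and X :: "complex mat" assume t: "t > 0" and X: "X \<in> carrier_mat ?m ?m"
  define Z where "Z = cond_exp ?T X"
  have Z: "Z \<in> ?T" unfolding Z_def by (rule cond_exp_in[OF sT X])
  have Zc: "Z \<in> carrier_mat ?m ?m" "adj Z \<in> carrier_mat ?m ?m" using subalgebraD(1)[OF sT Z] by auto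
  note sub = subalgebraD[OF sT]
  have "rel_form \<rho>' \<sigma>' t X \<le> rel_form \<rho>' \<sigma>' t Z"
    unfolding Z_def using \<sigma>'I IT
    by (intro rel_form_cond_exp_le[OF sT g\<rho>' \<rho>'T pinched_gram[OF pin'] _ X t]) auto
  \<comment> \<open>The form tests the states against \<open>adj Z\<close>, \<open>Z * adj Z\<close>
    and \<open>adj Z * Z\<close>, all in \<open>?T\<close>, and \<open>tensor_one\<close> respects
    products and adjoints.\<close>
  also have "\<dots> = rel_form \<rho> \<sigma> t (tensor_one ?m d Z)"
    unfolding rel_form_def adj_tensor_one[OF Zc(1)] tensor_one_mult[OF Zc, symmetric] tensor_one_mult[OF Zc(2,1), symmetric]
    using tr\<rho>[OF sub(6)[OF Z]] tr\<rho>[OF sub(4)[OF sub(6)[OF Z] Z]] tr\<sigma>[OF sub(4)[OF Z sub(6)[OF Z]]]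
    by simp
  finally show "\<exists>Y\<in>carrier_mat ?n ?n. rel_form (cond_exp ?T R) (cond_exp ?I R) t X \<le> rel_form \<rho> (cond_exp ?S1 \<rho>) t Y"
    unfolding \<rho>'_def \<sigma>'_def \<sigma>_def by (intro bexI[of _ "tensor_one ?m d Z"]) auto
qed

theorem theorem1:
  fixes dA dB dC dF :: nat and S T :: "complex mat set" and V \<rho> :: "complex mat"
  assumes "dA > 0" and "dB > 0" and "dC > 0"
    and "subalgebra dA S" and "subalgebra dA T"
    and "\<forall>X \<in> carrier_mat dA dA. cond_exp S (cond_exp T X) = cond_exp (S \<inter> T) X"
    and "\<forall>X \<in> carrier_mat dA dA. cond_exp T (cond_exp S X) = cond_exp (S \<inter> T) X"
    and "stinespring dA dF S V"
    and "density (dA*dB*dC) \<rho>"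
  shows "cond_ent_compl dA dB dC dF V \<rho> + cond_ent_alg dA dB dC T \<rho>
           \<ge> cond_ent_alg dA dB dC (S \<inter> T) \<rho>"
proof -
  note S = assms(4) and T = assms(5)
  have V: "V \<in> carrier_mat (dA * dF) dA" using assms(8) by (simp add: stinespring_def)
  have "gram (dA * dB * dC) \<rho>" using assms(9) psd_gram by (simp add: density_def)
  \<comment> \<open>The columns of \<open>M\<close> index the purifying space, of dimension
    \<open>m\<close>.\<close>
  then obtain m M where M: "M \<in> carrier_mat (dA * dB * dC) m" and \<rho>M: "\<rho> = M * adj M"
    by (auto simp: gram_def)
  define K where "K = reshape dA dB dC m M"
  define L where "L = reshape_dilated dA dB dC m M dF V"
  note K = reshape_carrier[OF M, folded K_def] and L = reshape_dilated_carrier[OF M, of dF V, folded L_def]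
  let ?\<rho> = "K * adj K" and ?R = "red_AC dA dB dC \<rho>"
  have g: "gram (dA * dC * m) ?\<rho>" using K unfolding gram_def by (auto simp: mult.assoc)
  then have \<rho>c: "?\<rho> \<in> carrier_mat (dA * (dC * m)) (dA * (dC * m))"
    using gram_hermitian by (simp add: mult.assoc)
  have Rc: "?R \<in> carrier_mat (dA * dC) (dA * dC)" by (simp add: red_AC_def)
  have "vn_entropy (on_first dA dB dF (compl_ch dA dF V) (red_AB dA dB dC \<rho>)) = vn_entropy (adj L * L)"
    unfolding \<rho>M on_first_compl_ch_reshape[OF M V] L_def[symmetric]
    using L by (intro vn_entropy_transpose) auto
  also have "\<dots> = vn_entropy (L * adj L)"
    using L by (intro vn_entropy_mult_commute) auto
  also have "L * adj L = cond_exp (ampliation dA (dC * m) S) ?\<rho>"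
    using on_first_cond_exp_reshape[OF M assms(8)] on_first_cond_exp[OF S \<rho>c] by (simp add: L_def K_def)
  finally have 1: "vn_entropy (on_first dA dB dF (compl_ch dA dF V) (red_AB dA dB dC \<rho>))
    = vn_entropy (cond_exp (ampliation dA (dC * m) S) ?\<rho>)" .
  have "vn_entropy (red_B dA dB dC \<rho>) = vn_entropy (adj K * K)"
    unfolding \<rho>M red_B_reshape[OF M] K_def[symmetric]
    using K by (intro vn_entropy_transpose) auto
  also have "\<dots> = vn_entropy ?\<rho>" using K by (intro vn_entropy_mult_commute) auto
  finally have 2: "vn_entropy (red_B dA dB dC \<rho>) = vn_entropy ?\<rho>" .
  have 3: "ptrace2 (dA * dC) m ?\<rho> = ?R" unfolding K_def \<rho>M by (rule ptrace2_reshape[OF M])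
  \<comment> \<open>The entropy of the state on C is subtracted on both sides and cancels.\<close>
  show ?thesis
    using commuting_square_entropy_gap[OF S T assms(7) g]
    unfolding cond_ent_compl_def cond_ent_alg_def 1 2 3
      on_first_cond_exp[OF T Rc] on_first_cond_exp[OF subalgebra_Int[OF S T] Rc]
    by simp
qed

end
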